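(* Let $\hat f_h^{\mathfrak n}=X^\top U^{\mathfrak n}S^{\mathfrak n}(E^{\mathfrak n})^\top Y$ be given and let $\hat f_h^{\mathfrak n+1}$ be the result of one step of the DLR-DG scheme with time step $\Delta t>0$. Assume there exist constants $\beta\in(0,1]$ and $\alpha>0$ such that $\|P_{U^{\mathfrak n}}U^{\mathrm{eq}}\|\ge\beta$ and $\|(E^{\mathrm{eq}})^\top A_\chi P^\chi_{E^{\mathfrak n}}\|_{A_{\boldsymbol 1}}\ge\alpha$. For any $\delta>0$, let $$\Delta t_0=\frac{\sqrt2}{\delta}\max\left\{\frac{r^{1/2}}{\beta\chi_{\min}},\ \frac{r^{1/2}\chi_{\max}^{1/2}}{\alpha\chi_{\min}^{3/2}}\right\}.$$ Then for any $\Delta t\ge\Delta t_0$, $$\|\varepsilon(\hat f_h^{\mathfrak n+1}-f_h^{\mathrm{eq}})\|_{L^2(\Omega)}\le(c+\delta_\chi)\,\|\varepsilon(\hat f_h^{\mathfrak n}-f_h^{\mathrm{eq}})\|_{L^2(\Omega)},$$ where $c=\frac{1}{1+\Delta t\,\chi_{\min}}$ and $\delta_\chi=\left(1+\frac{\chi_{\max}}{\chi_{\min}}\right)\delta$. Moreover, if $\hat f_h^{\mathfrak n}=f_h^{\mathrm{eq}}$, then for any $\Delta t>0$, $\hat f_h^{\mathfrak n+1}=f_h^{\mathrm{eq}}$.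
   Context: Let $\varepsilon_{\max}>0$, $\Omega=\Omega_\mu\times\Omega_\varepsilon$ with $\Omega_\mu=[-1,1]\ni\mu$, $\Omega_\varepsilon=[0,\varepsilon_{\max}]\ni\varepsilon$. The weighted inner product is $(v,w;\varepsilon^2)_\Omega=\int_0^{\varepsilon_{\max}}\int_{-1}^1 vw\,\varepsilon^2\,d\mu\,d\varepsilon$, and $\|\varepsilon w\|_{L^2(\Omega)}=(w,w;\varepsilon^2)_\Omega^{1/2}$. The emissivity $\eta=\eta(\varepsilon)>0$ (square integrable with respect to $\varepsilon^2d\varepsilon$) and the opacity $\chi=\chi(\varepsilon)$ are given, with constants $0<\chi_{\min}\le\chi\le\chi_{\max}$. Set $\mathcal A(f,w)=(\eta,w;\varepsilon^2)_\Omega-(\chi f,w;\varepsilon^2)_\Omega$. Partition $\Omega_\mu$ and $\Omega_\varepsilon$ into $N_\mu$ and $N_\varepsilon$ intervals; $V_{\mu,h}$, $V_{\varepsilon,h}$ are the spaces of (discontinuous) piecewise polynomials of degree at most $k$ on these partitions, and $V_h=V_{\mu,h}\otimes V_{\varepsilon,h}$. Let $m=(k+1)N_\mu$, $n=(k+1)N_\varepsilon$, $1\le r\le\min\{m,n\}$. Let $\{x_i(\mu)\}_{i=1}^m$, $\{y_j(\varepsilon)\}_{j=1}^n$ be the bases of $V_{\mu,h}$, $V_{\varepsilon,h}$ consisting of Legendre polynomials supported on single cells and orthonormal in the unweighted $L^2$ inner product of the cell; $X=[x_1,\dots,x_m]^\top$, $Y=[y_1,\dots,y_n]^\top$. $A_{\boldsymbol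 1}=[\int_{\Omega_\varepsilon}y_iy_j\varepsilon^2d\varepsilon]$, $A_\chi=[\int_{\Omega_\varepsilon}\chi y_iy_j\varepsilon^2d\varepsilon]$ are symmetric positive definite $n\times n$ matrices; $L_0=[\int_{-1}^1x_i\,d\mu]_i\in\mathbb R^{m\times1}$, $L_\eta=[\int_{\Omega_\varepsilon}\eta y_j\varepsilon^2d\varepsilon]_j\in\mathbb R^{n\times1}$. Norms: $\|\cdot\|$ is the Euclidean norm of column vectors; for $Z\in\mathbb R^{\ell\times n}$ and symmetric positive definite $M\in\mathbb R^{n\times n}$, $\|Z\|_M^2=\mathrm{tr}(ZMZ^\top)$. Equilibrium: $f_h^{\mathrm{eq}}\in V_h$ is the unique solution of $\mathcal A(f_h^{\mathrm{eq}},w_h)=0$ for all $w_h\in V_h$; its coefficient matrix is $F^{\mathrm{eq}}=L_0L_\eta^\top A_\chi^{-1}=U^{\mathrm{eq}}S^{\mathrm{eq}}(E^{\mathrm{eq}})^\top$ (i.e. $f_h^{\mathrm{eq}}=X^\top F^{\mathrm{eq}}Y$), where $U^{\mathrm{eq}}=L_0/\|L_0\|$, $E^{\mathrm{eq}}=A_\chi^{-1}L_\eta/\|L_\eta^\top A_\chi^{-1}\|_{A_{\boldsymbol 1}}$, $S^{\mathrm{eq}}=\|L_0\|\,\|L_\eta^\top A_\chi^{-1}\|_{A_{\boldsymbol 1}}$. Projections: $P_U=UU^\top$ for $U^\top U=I_r$; $P_E^\chi=E(E^\top A_\chi E)^{-1}E^\top$ for $E^\top A_{\boldsymbol 1}E=I_r$.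 One step of the DLR-DG scheme. $\hat f_h^{\mathfrak n}=X^\top U^{\mathfrak n}S^{\mathfrak n}(E^{\mathfrak n})^\top Y$ with $U^{\mathfrak n}\in\mathbb R^{m\times r}$, $S^{\mathfrak n}\in\mathbb R^{r\times r}$, $E^{\mathfrak n}\in\mathbb R^{n\times r}$, $(U^{\mathfrak n})^\top U^{\mathfrak n}=I_r=(E^{\mathfrak n})^\top A_{\boldsymbol 1}E^{\mathfrak n}$. With $V_1^{\mathfrak n}=\{X^\top\mathbf K(E^{\mathfrak n})^\top Y:\mathbf K\in\mathbb R^{m\times r}\}$, $V_2^{\mathfrak n}=\{X^\top U^{\mathfrak n}\mathbf L^\top Y:\mathbf L\in\mathbb R^{n\times r}\}$, find $f_{\mathbf K}=X^\top\mathbf K^{\mathfrak n+1}(E^{\mathfrak n})^\top Y\in V_1^{\mathfrak n}$ and $f_{\mathbf L}=X^\top U^{\mathfrak n}(\mathbf L^{\mathfrak n+1})^\top Y\in V_2^{\mathfrak n}$ with $\frac1{\Delta t}(f_{\mathbf K}-\hat f_h^{\mathfrak n},w_1;\varepsilon^2)_\Omega=\mathcal A(f_{\mathbf K},w_1)$ for all $w_1\in V_1^{\mathfrak n}$ and $\frac1{\Delta t}(f_{\mathbf L}-\hat f_h^{\mathfrak n},w_2;\varepsilon^2)_\Omega=\mathcal A(f_{\mathbf L},w_2)$ for all $w_2\in V_2^{\mathfrak n}$ (unique solutions); factor $\mathbf K^{\mathfrak n+1}=U^{\mathfrak n+1}R_{\mathbf K}$, $\mathbf L^{\mathfrak n+1}=E^{\mathfrak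 n+1}R_{\mathbf L}$ with $(U^{\mathfrak n+1})^\top U^{\mathfrak n+1}=I_r=(E^{\mathfrak n+1})^\top A_{\boldsymbol 1}E^{\mathfrak n+1}$ (QR and weighted QR; any choice); set $V_0^{\mathfrak n+1}=\{X^\top U^{\mathfrak n+1}S(E^{\mathfrak n+1})^\top Y:S\in\mathbb R^{r\times r}\}$ and let $\hat f_h^{\mathfrak n+1}=X^\top U^{\mathfrak n+1}S^{\mathfrak n+1}(E^{\mathfrak n+1})^\top Y\in V_0^{\mathfrak n+1}$ be the unique solution of $\frac1{\Delta t}(\hat f_h^{\mathfrak n+1}-\hat f_h^{\mathfrak n},w_0;\varepsilon^2)_\Omega=\mathcal A(\hat f_h^{\mathfrak n+1},w_0)$ for all $w_0\in V_0^{\mathfrak n+1}$. *)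

theory Defs
  imports "HOL-Analysis.Analysis" "HOL-Computational_Algebra.Polynomial"
begin

text \<open>Functions on \<open>[-1,1] \<times> [0,emax]\<close> are written in curried form \<open>v \<mu> \<epsilon>\<close>.\<close>

definition wip :: "real \<Rightarrow> (real \<Rightarrow> real \<Rightarrow> real) \<Rightarrow> (real \<Rightarrow> real \<Rightarrow> real) \<Rightarrow> real" where
  "wip emax v w =
     (LINT \<epsilon>|lebesgue_on {0..emax}. LINT \<mu>|lebesgue_on {-1..1}. v \<mu> \<epsilon> * w \<mu> \<epsilon> * \<epsilon>\<^sup>2)"

definition wnorm :: "real \<Rightarrow> (real \<Rightarrow> real \<Rightarrow> real) \<Rightarrow> real" where
  "wnorm emax w = sqrt (wip emax w w)"

definition Aform ::
  "real \<Rightarrow> (real \<Rightarrow> real) \<Rightarrow> (real \<Rightarrow> real) \<Rightarrow> (real \<Rightarrow> real \<Rightarrow> real) \<Rightarrow> (real \<Rightarrow> real \<Rightarrow> real) \<Rightarrow> real" where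
  "Aform emax eta chi f w =
     wip emax (\<lambda>\<mu> \<epsilon>. eta \<epsilon>) w - wip emax (\<lambda>\<mu> \<epsilon>. chi \<epsilon> * f \<mu> \<epsilon>) w"

definition partition_of :: "real \<Rightarrow> real \<Rightarrow> nat \<Rightarrow> (nat \<Rightarrow> real) \<Rightarrow> bool" where
  "partition_of a b N t \<longleftrightarrow> t 0 = a \<and> t N = b \<and> (\<forall>i<N. t i < t (Suc i))"

text \<open>
  Cells are half-open, except that the last one is closed, so that they partition the whole
  closed interval.  Elements of the finite element spaces are represented by functions that vanish
  outside of the domain; with this choice of values at the breakpoints, equality almost everywhere
  of two elements is equality of functions.
\<close>

definition cell :: "nat \<Rightarrow> (nat \<Rightarrow> real) \<Rightarrow> nat \<Rightarrow> real set" where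
  "cell N t i = (if Suc i = N then {t i..t (Suc i)} else {t i..<t (Suc i)})"

definition pw_poly :: "nat \<Rightarrow> nat \<Rightarrow> (nat \<Rightarrow> real) \<Rightarrow> (real \<Rightarrow> real) set" where
  "pw_poly k N t =
     {v. \<exists>p :: nat \<Rightarrow> real poly. (\<forall>i<N. degree (p i) \<le> k) \<and>
           v = (\<lambda>s. \<Sum>i<N. indicator (cell N t i) s * poly (p i) s)}"

definition tensor_space ::
  "(real \<Rightarrow> real) set \<Rightarrow> (real \<Rightarrow> real) set \<Rightarrow> (real \<Rightarrow> real \<Rightarrow> real) set" where
  "tensor_space V W =
     {f. \<exists>(q :: nat) v w. (\<forall>l<q. v l \<in> V \<and> w l \<in> W) \<and>
           f = (\<lambda>\<mu> \<epsilon>. \<Sum>l<q. v l \<mu> * w l \<epsilon>)}"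

text \<open>Rodrigues' formula.\<close>

definition legendre :: "nat \<Rightarrow> real poly" where
  "legendre j = smult (1 / (2 ^ j * fact j)) ((pderiv ^^ j) ([:-1, 0, 1:] ^ j))"

definition cell_legendre :: "nat \<Rightarrow> (nat \<Rightarrow> real) \<Rightarrow> nat \<Rightarrow> nat \<Rightarrow> real \<Rightarrow> real" where
  "cell_legendre N t i j s =
     indicator (cell N t i) s *
     poly (legendre j) ((2 * s - t i - t (Suc i)) / (t (Suc i) - t i))"

definition cell_legendre_normalized ::
  "nat \<Rightarrow> (nat \<Rightarrow> real) \<Rightarrow> nat \<Rightarrow> nat \<Rightarrow> real \<Rightarrow> real" where
  "cell_legendre_normalized N t i j s =
     cell_legendre N t i j s /
     sqrt (LINT u|lebesgue_on {t i..t (Suc i)}. (cell_legendre N t i j u)\<^sup>2)"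

text \<open>
  The basis is indexed by a finite type, in an arbitrary order given by \<open>\<sigma>\<close>.  The bijection
  forces the index type to have \<open>(k + 1) * N\<close> elements.
\<close>

definition legendre_basis :: "nat \<Rightarrow> nat \<Rightarrow> (nat \<Rightarrow> real) \<Rightarrow> ('i::finite \<Rightarrow> real \<Rightarrow> real) \<Rightarrow> bool" where
  "legendre_basis k N t b \<longleftrightarrow>
     (\<exists>\<sigma>. bij_betw \<sigma> (UNIV :: 'i set) ({..<N} \<times> {..k}) \<and>
          (\<forall>i. b i = cell_legendre_normalized N t (fst (\<sigma> i)) (snd (\<sigma> i))))"

text \<open>The function \<open>X\<^sup>T F Y\<close> with coefficient matrix \<open>F\<close>.\<close>

definition fun_of_coeffs ::
  "('m::finite \<Rightarrow> real \<Rightarrow> real) \<Rightarrow> ('n::finite \<Rightarrow> real \<Rightarrow> real) \<Rightarrow> real^'n^'m \<Rightarrow> real \<Rightarrow> real \<Rightarrow> real" where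
  "fun_of_coeffs x y F \<mu> \<epsilon> = (\<chi> i. x i \<mu>) \<bullet> (F *v (\<chi> j. y j \<epsilon>))"

definition weighted_gram :: "real \<Rightarrow> (real \<Rightarrow> real) \<Rightarrow> ('n::finite \<Rightarrow> real \<Rightarrow> real) \<Rightarrow> real^'n^'n" where
  "weighted_gram emax g y =
     (\<chi> i j. LINT \<epsilon>|lebesgue_on {0..emax}. g \<epsilon> * y i \<epsilon> * y j \<epsilon> * \<epsilon>\<^sup>2)"

abbreviation gram_one :: "real \<Rightarrow> ('n::finite \<Rightarrow> real \<Rightarrow> real) \<Rightarrow> real^'n^'n" where
  "gram_one emax y \<equiv> weighted_gram emax (\<lambda>_. 1) y"

text \<open>
  Columns are matrices of type \<open>real^1^'m\<close>; the library norm of such a matrix is the Euclidean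
  norm of the column.
\<close>

definition L0 :: "('m::finite \<Rightarrow> real \<Rightarrow> real) \<Rightarrow> real^1^'m" where
  "L0 x = (\<chi> i _. LINT \<mu>|lebesgue_on {-1..1}. x i \<mu>)"

definition Leta :: "real \<Rightarrow> (real \<Rightarrow> real) \<Rightarrow> ('n::finite \<Rightarrow> real \<Rightarrow> real) \<Rightarrow> real^1^'n" where
  "Leta emax eta y = (\<chi> j _. LINT \<epsilon>|lebesgue_on {0..emax}. eta \<epsilon> * y j \<epsilon> * \<epsilon>\<^sup>2)"

definition norm_wrt :: "real^'n^'n \<Rightarrow> real^'n^'l \<Rightarrow> real" where
  "norm_wrt M Z = sqrt (trace (Z ** M ** transpose Z))"

definition proj_U :: "real^'r^'m \<Rightarrow> real^'m^'m" where
  "proj_U U = U ** transpose U"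

definition proj_E :: "real^'n^'n \<Rightarrow> real^'r^'n \<Rightarrow> real^'n^'n" where
  "proj_E Achi E = E ** matrix_inv (transpose E ** Achi ** E) ** transpose E"

definition discrete_equilibrium ::
  "real \<Rightarrow> (real \<Rightarrow> real) \<Rightarrow> (real \<Rightarrow> real) \<Rightarrow> (real \<Rightarrow> real \<Rightarrow> real) set \<Rightarrow>
   (real \<Rightarrow> real \<Rightarrow> real) \<Rightarrow> bool" where
  "discrete_equilibrium emax eta chi V f \<longleftrightarrow> f \<in> V \<and> (\<forall>w\<in>V. Aform emax eta chi f w = 0)"

definition U_eq :: "('m::finite \<Rightarrow> real \<Rightarrow> real) \<Rightarrow> real^1^'m" where
  "U_eq x = (1 / norm (L0 x)) *\<^sub>R L0 x"

definition E_eq ::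
  "real \<Rightarrow> (real \<Rightarrow> real) \<Rightarrow> (real \<Rightarrow> real) \<Rightarrow> ('n::finite \<Rightarrow> real \<Rightarrow> real) \<Rightarrow> real^1^'n" where
  "E_eq emax eta chi y =
     (let Ainv = matrix_inv (weighted_gram emax chi y) in
      (1 / norm_wrt (gram_one emax y) (transpose (Leta emax eta y) ** Ainv)) *\<^sub>R
        (Ainv ** Leta emax eta y))"

definition galerkin_step ::
  "real \<Rightarrow> (real \<Rightarrow> real) \<Rightarrow> (real \<Rightarrow> real) \<Rightarrow> real \<Rightarrow> (real \<Rightarrow> real \<Rightarrow> real) set \<Rightarrow>
   (real \<Rightarrow> real \<Rightarrow> real) \<Rightarrow> (real \<Rightarrow> real \<Rightarrow> real) \<Rightarrow> bool" where
  "galerkin_step emax eta chi dt V f g \<longleftrightarrow>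
     g \<in> V \<and>
     (\<forall>w\<in>V. 1 / dt * wip emax (\<lambda>\<mu> \<epsilon>. g \<mu> \<epsilon> - f \<mu> \<epsilon>) w = Aform emax eta chi g w)"

text \<open>
  The factors \<open>(U, S, E)\<close> are mapped to \<open>(U', S', E')\<close>.  The step is a relation since the
  orthonormal factorisations of \<open>K\<close> and \<open>L\<close> are not unique, in particular when these
  matrices are rank deficient; \<open>RK\<close> and \<open>RL\<close> are not required to be triangular.
\<close>

definition dlr_dg_step ::
  "real \<Rightarrow> (real \<Rightarrow> real) \<Rightarrow> (real \<Rightarrow> real) \<Rightarrow> real \<Rightarrow>
   ('m::finite \<Rightarrow> real \<Rightarrow> real) \<Rightarrow> ('n::finite \<Rightarrow> real \<Rightarrow> real) \<Rightarrow>
   real^'r^'m \<Rightarrow> real^'r^'r \<Rightarrow> real^'r^'n \<Rightarrow>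
   real^'r^'m \<Rightarrow> real^'r^'r \<Rightarrow> real^'r^'n \<Rightarrow> bool" where
  "dlr_dg_step emax eta chi dt x y U S E U' S' E' \<longleftrightarrow>
     (let f = fun_of_coeffs x y (U ** S ** transpose E);
          V1 = range (\<lambda>K :: real^'r^'m. fun_of_coeffs x y (K ** transpose E));
          V2 = range (\<lambda>L :: real^'r^'n. fun_of_coeffs x y (U ** transpose L));
          V0 = range (\<lambda>T :: real^'r^'r. fun_of_coeffs x y (U' ** T ** transpose E'))
      in (\<exists>K RK. galerkin_step emax eta chi dt V1 f (fun_of_coeffs x y (K ** transpose E)) \<and>
                 K = U' ** RK) \<and>
         (\<exists>L RL. galerkin_step emax eta chi dt V2 f (fun_of_coeffs x y (U ** transpose L)) \<and>
                 L = E' ** RL) \<and>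
         transpose U' ** U' = mat 1 \<and>
         transpose E' ** gram_one emax y ** E' = mat 1 \<and>
         galerkin_step emax eta chi dt V0 f (fun_of_coeffs x y (U' ** S' ** transpose E')))"

end

theory Submission
  imports Defs
begin

text \<open>
  In the orthonormal bases every function of the scheme is a coefficient matrix, the weighted inner product
  becomes the form of \<open>A\<close> (the Gram matrix of the weight \<open>\<epsilon>\<^sup>2\<close>) applied row by row, and the collision
  term becomes the form of \<open>B\<close> (the Gram matrix of the weight \<open>\<chi> \<epsilon>\<^sup>2\<close>).  The bounds on the opacity
  say that \<open>B\<close> lies between \<open>\<chi>\<^sub>m\<^sub>i\<^sub>n A\<close> and \<open>\<chi>\<^sub>m\<^sub>a\<^sub>x A\<close>.  The discrete equilibrium is a matrix of rank one,
  \<open>s u e\<^sup>T\<close>.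

  Each substep is an implicit Euler step towards the equilibrium in its own space, that is, a Galerkin
  projection for the form of \<open>A + dt B\<close>.  In the final space it is quasi-optimal
  (\<open>galerkin_quasi_optimality\<close>): the new error is at most the old error divided by \<open>1 + dt \<chi>\<^sub>m\<^sub>i\<^sub>n\<close>, plus
  \<open>1 + \<chi>\<^sub>m\<^sub>a\<^sub>x / \<chi>\<^sub>m\<^sub>i\<^sub>n\<close> times the distance of the equilibrium from the final space.  It remains to see
  that this distance is at most \<open>\<delta>\<close> times the old error.

  The projection of \<open>s u e\<^sup>T\<close> onto the final space misses the part \<open>n\<close> of \<open>u\<close> outside the new
  angular basis and the part \<open>e'\<close> of \<open>e\<close> outside the new energy basis.  The new angular basis
  contains the range of the K-step solution, so the K-step equation tested in direction \<open>n\<close> contains only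
  the old error and the equilibrium.  For a large time step the collision term dominates and \<open>n\<close> must be
  small, provided the old energy basis overlaps with the equilibrium (\<open>K_step_error\<close>).  The L-step
  controls \<open>e'\<close> in the same manner from the overlap of the old angular basis (\<open>L_step_error\<close>).

  The delicate point is that in the K-step the overlaps of \<open>e\<close> with the old energy basis for the two
  weights may have opposite signs and cancel.  If they do, then \<open>e\<close> is far from this basis and the old error
  is large anyway; \<open>quadratic_overlap_bound\<close> trades the two effects against each other.

  The fixed-point property is the case of a vanishing old error: given \<open>dt\<close>, choose \<open>\<delta>\<close> so large that the
  estimate applies.
\<close>

section \<open>Semidefinite forms and Galerkin projections\<close>

definition psd_form :: "('v::real_vector \<Rightarrow> 'v \<Rightarrow> real) \<Rightarrow> bool" where
  "psd_form a \<longleftrightarrow> bilinear a \<and> (\<forall>v w. a v w = a w v) \<and> (\<forall>v. 0 \<le> a v v)"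

lemma psd_formD:
  assumes "psd_form a"
  shows "a (u + v) w = a u w + a v w" "a w (u + v) = a w u + a w v"
    "a (u - v) w = a u w - a v w" "a w (u - v) = a w u - a w v"
    "a (c *\<^sub>R u) v = c * a u v" "a u (c *\<^sub>R v) = c * a u v"
    "a u v = a v u" "0 \<le> a v v"
  using assms unfolding psd_form_def
  by (auto simp: bilinear_ladd bilinear_radd bilinear_lsub bilinear_rsub bilinear_lmul bilinear_rmul)

text \<open>
  The value of \<^term>\<open>a\<close> at \<^term>\<open>v - t *\<^sub>R w\<close> is a nonnegative quadratic polynomial in \<^term>\<open>t\<close>.  If
  \<^term>\<open>a w w = 0\<close> it is affine, so that its slope must vanish; otherwise evaluate it at its minimum.
  Definiteness cannot be assumed: below, the inequality is also applied to the difference of two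
  weighted forms, which may be degenerate.
\<close>

lemma psd_form_Cauchy_Schwarz:
  assumes a: "psd_form a"
  shows "(a v w)\<^sup>2 \<le> a v v * a w w"
proof -
  have *: "0 \<le> a v v - 2 * t * a v w + t\<^sup>2 * a w w" for t
  proof -
    have "0 \<le> a (v - t *\<^sub>R w) (v - t *\<^sub>R w)"
      using psd_formD(8)[OF a] .
    also have "\<dots> = a v v - 2 * t * a v w + t\<^sup>2 * a w w"
      using psd_formD(7)[OF a, of w v]
      by (simp add: psd_formD(3-6)[OF a] power2_eq_square algebra_simps)
    finally show ?thesis .
  qed
  show ?thesis
  proof (cases "a w w = 0")
    case True
    have "a v w = 0"
    proof (rule ccontr)
      assume "a v w \<noteq> 0"
      then show False
        using *[of "(a v v + 1) / (2 * a v w)"] True by simp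
    qed
    then show ?thesis using True by simp
  next
    case False
    then have "a w w > 0" using psd_formD(8)[OF a, of w] by simp
    then show ?thesis
      using *[of "a v w / a w w"] by (simp add: power2_eq_square field_simps)
  qed
qed

lemma psd_form_Cauchy_Schwarz_sqrt:
  assumes a: "psd_form a"
  shows "\<bar>a v w\<bar> \<le> sqrt (a v v) * sqrt (a w w)"
  using psd_form_Cauchy_Schwarz[OF a, of v w]
  by (metis real_sqrt_abs real_sqrt_le_mono real_sqrt_mult)

lemma psd_form_triangle:
  assumes a: "psd_form a"
  shows "sqrt (a (v + w) (v + w)) \<le> sqrt (a v v) + sqrt (a w w)"
proof (rule real_le_lsqrt)
  show "a (v + w) (v + w) \<le> (sqrt (a v v) + sqrt (a w w))\<^sup>2"
    using psd_form_Cauchy_Schwarz_sqrt[OF a, of v w] psd_formD(7)[OF a, of w v]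
      psd_formD(8)[OF a, of v] psd_formD(8)[OF a, of w]
    by (simp add: psd_formD(1,2)[OF a] power2_eq_square algebra_simps)
  show "0 \<le> sqrt (a v v) + sqrt (a w w)"
    using psd_formD(8)[OF a] by simp
qed

lemma psd_form_add_scaled:
  assumes a: "psd_form a" and b: "psd_form b" and "\<And>v. 0 \<le> a v v + c * b v v"
  shows "psd_form (\<lambda>v w. a v w + c * b v w)"
proof -
  have "bilinear (\<lambda>v w. a v w + c * b v w)"
    unfolding bilinear_def
    by (auto intro!: linearI simp: psd_formD(1,2,5,6)[OF a] psd_formD(1,2,5,6)[OF b] algebra_simps)
  then show ?thesis
    using psd_formD(7)[OF a] psd_formD(7)[OF b] assms(3) unfolding psd_form_def by auto
qed

text \<open>
  Here \<^term>\<open>v\<close> stands for an arbitrary element of the Galerkin space.  Testing with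
  \<^term>\<open>f1 - v\<close> bounds this difference by the old error, damped by \<^term>\<open>1 / c1\<close>, and by the approximation
  error of \<^term>\<open>v\<close>, amplified by the condition number \<^term>\<open>c2 / c1\<close> of \<^term>\<open>B\<close> relative to \<^term>\<open>a\<close>.
\<close>

lemma galerkin_quasi_optimality:
  assumes a: "psd_form a" and B: "psd_form B"
    and "0 < c1" and lower: "\<And>v. c1 * a v v \<le> B v v" and upper: "\<And>v. B v v \<le> c2 * a v v"
    and "0 \<le> c2"
    and galerkin: "B (f1 - feq) (f1 - v) = a (f0 - feq) (f1 - v)"
  shows "sqrt (a (f1 - feq) (f1 - feq))
    \<le> 1 / c1 * sqrt (a (f0 - feq) (f0 - feq)) + (1 + c2 / c1) * sqrt (a (v - feq) (v - feq))"
proof -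
  define N where "N z = sqrt (a z z)" for z
  have N0: "0 \<le> N z" for z using psd_formD(8)[OF a] by (simp add: N_def)
  have N2: "a z z = (N z)\<^sup>2" for z using psd_formD(8)[OF a] by (simp add: N_def)
  define w where "w = f1 - v"
  define p where "p = v - feq"
  have f1: "f1 - feq = w + p" by (simp add: w_def p_def)
  have "B w w = a (f0 - feq) w - B p w"
    using galerkin psd_formD(1)[OF B, of w p w] unfolding f1 w_def[symmetric] by simp
  moreover have "a (f0 - feq) w \<le> N (f0 - feq) * N w"
    using psd_form_Cauchy_Schwarz_sqrt[OF a, of "f0 - feq" w] by (simp add: N_def)
  moreover have "- B p w \<le> c2 * N p * N w"
  proof -
    have "(B p w)\<^sup>2 \<le> B p p * B w w" by (rule psd_form_Cauchy_Schwarz[OF B])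
    also have "\<dots> \<le> (c2 * a p p) * (c2 * a w w)"
      using upper psd_formD(8)[OF B] psd_formD(8)[OF a] \<open>0 \<le> c2\<close> by (intro mult_mono) auto
    also have "\<dots> = (c2 * N p * N w)\<^sup>2" by (simp add: N2 power2_eq_square)
    finally have "\<bar>B p w\<bar> \<le> c2 * N p * N w"
      using \<open>0 \<le> c2\<close> N0 by (metis abs_le_square_iff abs_of_nonneg mult_nonneg_nonneg)
    then show ?thesis by simp
  qed
  moreover have "c1 * (N w)\<^sup>2 \<le> B w w" using lower by (simp add: N2[symmetric])
  ultimately have "c1 * N w * N w \<le> (N (f0 - feq) + c2 * N p) * N w"
    by (simp add: power2_eq_square algebra_simps)
  then have "c1 * N w \<le> N (f0 - feq) + c2 * N p"
    using N0[of w] N0[of p] N0[of "f0 - feq"] \<open>0 \<le> c2\<close>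
    by (cases "N w = 0") (auto simp: mult_le_cancel_right)
  then have "N w \<le> 1 / c1 * N (f0 - feq) + c2 / c1 * N p"
    using \<open>0 < c1\<close> by (simp add: field_simps)
  moreover have "N (w + p) \<le> N w + N p"
    unfolding N_def by (rule psd_form_triangle[OF a])
  ultimately show ?thesis
    unfolding f1 unfolding p_def[symmetric] N_def[symmetric] by (simp add: algebra_simps)
qed

section \<open>Forms on vectors and matrices\<close>

\<comment> \<open>Products with a transposed matrix stay in the form \<^term>\<open>transpose E *v w\<close>, which composes by
  associativity with the matrices \<^term>\<open>A ** E\<close>.\<close>
declare transpose_matrix_vector [simp del]

lemma matrix_diff_ldistrib: "A ** (B - C) = A ** B - A ** (C :: real^'n^'m)"
  by (simp add: vec_eq_iff matrix_matrix_mult_def sum_subtractf right_diff_distrib)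

lemma matrix_diff_rdistrib: "(A - B) ** C = A ** C - B ** (C :: real^'n^'m)"
  by (simp add: vec_eq_iff matrix_matrix_mult_def sum_subtractf left_diff_distrib)

definition vform :: "real^'n^'n \<Rightarrow> real^'n \<Rightarrow> real^'n \<Rightarrow> real" where
  "vform A v w = v \<bullet> (A *v w)"

definition mform :: "real^'n^'n \<Rightarrow> real^'n^'m \<Rightarrow> real^'n^'m \<Rightarrow> real" where
  "mform A F G = (\<Sum>i\<in>UNIV. vform A (F $ i) (G $ i))"

definition outer :: "real^'m \<Rightarrow> real^'n \<Rightarrow> real^'n^'m" where
  "outer u v = (\<chi> i j. u $ i * v $ j)"

lemma bilinear_vform: "bilinear (vform A)"
  unfolding bilinear_def vform_def
  by (auto intro!: linearI simp: inner_add_left matrix_vector_right_distrib inner_add_right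
      matrix_vector_mult_scaleR)

lemma vform_sym: "transpose A = A \<Longrightarrow> vform A v w = vform A w v"
  unfolding vform_def
  by (metis dot_lmul_matrix inner_commute transpose_matrix_vector)

lemma psd_vform:
  assumes "transpose A = A" "\<And>v. 0 \<le> vform A v v"
  shows "psd_form (vform A)"
  using assms bilinear_vform vform_sym unfolding psd_form_def by blast

lemma vform_add_scaleR: "vform (A + c *\<^sub>R B) v w = vform A v w + c * vform B v w"
  unfolding vform_def
  by (simp add: matrix_vector_mult_add_rdistrib scaleR_matrix_vector_assoc[symmetric] inner_add_right)

lemma psd_mform:
  assumes "psd_form (vform A)"
  shows "psd_form (mform A :: real^'n^'m \<Rightarrow> _)"
proof -
  have "bilinear (mform A :: real^'n^'m \<Rightarrow> _)"
    unfolding bilinear_def mform_def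
    by (auto intro!: linearI simp: psd_formD(1,2,5,6)[OF assms] sum.distrib sum_distrib_left)
  then show ?thesis
    using psd_formD(7,8)[OF assms] unfolding psd_form_def mform_def
    by (auto intro!: sum_nonneg sum.cong)
qed

lemma mform_add_scaleR: "mform (A + c *\<^sub>R B) F G = mform A F G + c * mform B F G"
  unfolding mform_def by (simp add: vform_add_scaleR sum.distrib sum_distrib_left)

lemma outer_nth: "outer u v $ i = (u $ i) *\<^sub>R v"
  by (simp add: outer_def vec_eq_iff)

lemma outer_scaleR_left: "outer (c *\<^sub>R u) v = c *\<^sub>R outer u v"
  by (simp add: vec_eq_iff outer_def)

lemma mform_outer_right: "mform A F (outer n g) = n \<bullet> (F *v (A *v g))"
  by (simp add: mform_def vform_def outer_nth matrix_vector_mult_scaleR inner_vec_def[of n]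
      matrix_vector_mul_component)

lemma outer_mult_vec: "outer u v *v z = (v \<bullet> z) *\<^sub>R u"
  by (simp add: vec_eq_iff matrix_vector_mul_component outer_nth)

lemma mform_outer_outer: "mform A (outer u v) (outer n g) = (u \<bullet> n) * vform A v g"
  by (simp add: mform_outer_right outer_mult_vec vform_def inner_commute)

lemma outer_mult_transpose: "outer n c ** transpose E = outer n (E *v c)"
  by (simp add: vec_eq_iff matrix_matrix_mult_def outer_def transpose_def matrix_vector_mult_def
      sum_distrib_left mult_ac)

lemma mult_transpose_outer: "U ** transpose (outer g d) = outer (U *v d) g"
  by (simp add: vec_eq_iff matrix_matrix_mult_def outer_def transpose_def matrix_vector_mult_def
      sum_distrib_right sum_distrib_left mult_ac)

lemma mult_outer: "U ** outer c d = outer (U *v c) d"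
  by (simp add: vec_eq_iff matrix_matrix_mult_def outer_def matrix_vector_mult_def
      sum_distrib_right sum_distrib_left mult_ac)

lemma vform_scaleR: "vform (c *\<^sub>R A) v w = c * vform A v w"
  unfolding vform_def by (simp add: scaleR_matrix_vector_assoc[symmetric])

lemma mform_definite:
  assumes A: "psd_form (vform A)" and definite: "\<And>v. vform A v v = 0 \<Longrightarrow> v = 0"
    and zero: "mform A F F = 0"
  shows "F = 0"
proof -
  have "vform A (F $ i) (F $ i) = 0" for i
    using zero psd_formD(8)[OF A] unfolding mform_def by (simp add: sum_nonneg_eq_0_iff)
  then show ?thesis using definite by (simp add: vec_eq_iff)
qed

section \<open>What the K- and L-steps retain of the equilibrium\<close>

lemma vform_mult_vec_left: "vform A (E *v b) w = b \<bullet> (transpose E *v (A *v w))"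
  unfolding vform_def by (metis dot_lmul_matrix inner_commute transpose_matrix_vector)

lemma vform_congruence: "vform A (E *v b) (E *v c) = vform (transpose E ** A ** E) b c"
  unfolding vform_mult_vec_left by (simp add: vform_def matrix_vector_mul_assoc matrix_mul_assoc)

text \<open>
  Cancellation of a norm that may vanish.
\<close>

lemma mult_right_le_imp_le':
  fixes x y z :: real
  assumes "x * z \<le> y * z" "0 \<le> z" "z = 0 \<Longrightarrow> x \<le> y"
  shows "x \<le> y"
  using assms by (metis less_le mult_right_le_imp_le)

text \<open>
  Up to the factor \<^term>\<open>d - c\<close>, the difference of the two sides is the square of
  \<^term>\<open>(d - c) * t - c * v\<close> plus a multiple of the slack in the hypothesis.
\<close>

lemma weighted_square_add_le:
  fixes t v :: real
  assumes "0 < c" "c \<le> d" "0 \<le> s" and v: "c * v\<^sup>2 \<le> (d - c) * s"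
  shows "c * (t + v)\<^sup>2 \<le> d * (t\<^sup>2 + s)"
proof (cases "d = c")
  case True
  then have "v = 0" using v \<open>0 < c\<close> by (simp add: mult_le_0_iff)
  then show ?thesis using True \<open>0 < c\<close> \<open>0 \<le> s\<close> by simp
next
  case False
  then have "0 < d - c" using \<open>c \<le> d\<close> by simp
  have "c * (c * v\<^sup>2) \<le> c * ((d - c) * s)" using v \<open>0 < c\<close> by (intro mult_left_mono) auto
  moreover have "0 \<le> ((d - c) * t - c * v)\<^sup>2" by simp
  ultimately have "(d - c) * (c * (t + v)\<^sup>2) \<le> (d - c) * (d * (t\<^sup>2 + s))"
    using mult_left_mono[OF v, of "d - c"] \<open>0 < d - c\<close>
    by (simp add: power2_eq_square algebra_simps)
  then show ?thesis using \<open>0 < d - c\<close> by simp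
qed

text \<open>
  This is where the hypothesis on the energy basis enters.  Split \<^term>\<open>e\<close> into its \<^term>\<open>A\<close>-orthogonal
  projection \<open>E a\<close> onto the column space of \<^term>\<open>E\<close> and a remainder \<open>q\<close>.  The vector \<^term>\<open>T\<close> that controls
  the K-step mixes the two weights and may be small, or even zero, when \<open>A\<close>- and \<open>B\<close>-overlaps cancel.
  Such a cancellation forces \<open>q\<close> to be large: the coefficient vector \<^term>\<open>p\<close> of the \<^term>\<open>B\<close>-projection
  satisfies \<open>(1 + dt G) p = T + (p - a)\<close> with \<open>G = E\<^sup>T B E\<close>, and \<open>p - a\<close> is bounded by
  \<open>q\<close>.  Hence \<open>T\<close> and \<open>q\<close> together, that is \<^term>\<open>vform A z z\<close>, dominate \<open>dt p\<close>.

  Since \<open>q\<close> is \<^term>\<open>A\<close>-orthogonal to the columns of \<^term>\<open>E\<close>, the bound of \<open>p - a\<close> may use the form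
  \<open>B - cm A\<close> instead of \<^term>\<open>B\<close>.  This gives the factor \<^term>\<open>cM - cm\<close> in place of \<^term>\<open>cM\<close>, which is just
  what makes the final constant equal to \<^term>\<open>cM\<close>.
\<close>

lemma quadratic_overlap_bound:
  fixes p :: "real^'r"
  assumes A: "psd_form (vform A)" and B: "psd_form (vform B)"
    and "0 < cm" and "cm \<le> cM" and lower: "\<And>v. cm * vform A v v \<le> vform B v v"
    and upper: "\<And>v. vform B v v \<le> cM * vform A v v"
    and E_orth: "transpose E ** A ** E = mat 1"
    and p: "(transpose E ** B ** E) *v p = transpose E *v (B *v e)"
    and "0 \<le> dt"
    and T_def: "T = transpose E *v ((A + dt *\<^sub>R B) *v e)"
    and z_def: "z = E *v T + (e - E *v (transpose E *v (A *v e)))"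
  shows "cm * (dt * cm * norm p)\<^sup>2 \<le> cM * vform A z z"
    and "vform A z z = T \<bullet> T + vform A e (z - E *v T)"
    and "transpose E *v (A *v (z - E *v T)) = 0"
proof -
  define a where "a = transpose E *v (A *v e)"
  define q where "q = e - E *v a"
  define v where "v = p - a"
  let ?G = "transpose E ** B ** E"
  let ?s2 = "vform A q q"
  have orth: "vform A (E *v b) (E *v c) = b \<bullet> c" for b c
    unfolding vform_congruence E_orth by (simp add: vform_def)
  have E_A_E: "transpose E *v (A *v (E *v c)) = c" for c
    by (simp add: matrix_vector_mul_assoc matrix_mul_assoc E_orth)
  have Eq0: "transpose E *v (A *v q) = 0"
    by (simp add: q_def matrix_vector_mult_diff_distrib E_A_E a_def)
  have Aq: "vform A (E *v c) q = 0" "vform A q (E *v c) = 0" for c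
    using psd_formD(7)[OF A, of q "E *v c"] by (simp_all add: vform_mult_vec_left Eq0)
  have z: "z = E *v T + q" by (simp add: z_def q_def a_def)
  show "transpose E *v (A *v (z - E *v T)) = 0"
    by (simp add: z Eq0)
  have zz: "vform A z z = T \<bullet> T + ?s2"
    by (simp add: z psd_formD(1,2)[OF A] orth Aq)
  have e: "e = E *v a + q" by (simp add: q_def)
  show "vform A z z = T \<bullet> T + vform A e (z - E *v T)"
  proof -
    have "vform A e q = vform A (E *v a + q) q" by (subst e) simp
    then show ?thesis by (simp add: zz psd_formD(1)[OF A] Aq) (simp add: z)
  qed
  have sigma0: "0 \<le> ?s2" by (rule psd_formD(8)[OF A])
  have Gv: "?G *v v = transpose E *v (B *v q)"
    by (simp add: v_def matrix_vector_mult_diff_distrib p q_def matrix_vector_mul_assoc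
        matrix_mul_assoc)
  have vGv: "vform ?G v v = vform B (E *v v) (E *v v)" by (simp add: vform_congruence)
  have G_lower: "cm * (norm c)\<^sup>2 \<le> vform ?G c c" for c
    using lower[of "E *v c"] by (simp add: vform_congruence[symmetric] orth power2_norm_eq_inner)
  have cMcm: "cm * ?s2 \<le> cM * ?s2" using lower[of q] upper[of q] by linarith
  \<comment> \<open>\<^term>\<open>q\<close> is \<^term>\<open>A\<close>-orthogonal to the columns of \<^term>\<open>E\<close>, so subtracting \<^term>\<open>cm\<close> times the
    form of \<^term>\<open>A\<close> changes nothing in the pairing with them but sharpens its Cauchy-Schwarz bound.\<close>
  have BmA: "psd_form (\<lambda>x w. vform B x w + (- cm) * vform A x w)"
    using lower by (intro psd_form_add_scaled A B) simp
  have "vform ?G v v * vform ?G v v \<le> (cM - cm) * ?s2 * vform ?G v v"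
  proof -
    have "(vform ?G v v)\<^sup>2 = (vform B (E *v v) q + (- cm) * vform A (E *v v) q)\<^sup>2"
      by (simp add: Aq vform_mult_vec_left Gv[symmetric]) (simp add: vform_def Eq0)
    also have "\<dots> \<le> (vform B (E *v v) (E *v v) + (- cm) * vform A (E *v v) (E *v v))
        * (vform B q q + (- cm) * ?s2)"
      by (rule psd_form_Cauchy_Schwarz[OF BmA])
    also have "\<dots> \<le> vform ?G v v * (cM * ?s2 - cm * ?s2)"
      using upper[of q] lower[of q] psd_formD(8)[OF B, of "E *v v"] \<open>0 < cm\<close>
      by (intro mult_mono) (auto simp: vGv orth)
    finally show ?thesis by (simp only: power2_eq_square left_diff_distrib mult.commute)
  qed
  moreover have "0 \<le> vform ?G v v" unfolding vGv by (rule psd_formD(8)[OF B])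
  moreover have "0 \<le> (cM - cm) * ?s2" using cMcm by (simp add: algebra_simps)
  ultimately have "vform ?G v v \<le> (cM - cm) * ?s2"
    by (metis mult_right_le_imp_le')
  then have v: "cm * (norm v)\<^sup>2 \<le> (cM - cm) * ?s2" using G_lower[of v] by linarith
  have T: "T + v = p + dt *\<^sub>R (?G *v p)"
    by (simp add: T_def v_def p a_def matrix_vector_mult_add_rdistrib matrix_vector_right_distrib
        scaleR_matrix_vector_assoc[symmetric] matrix_vector_mult_scaleR)
  have "dt * cm * (norm p)\<^sup>2 \<le> (p + dt *\<^sub>R (?G *v p)) \<bullet> p"
    using mult_left_mono[OF G_lower[of p] \<open>0 \<le> dt\<close>]
    by (simp add: inner_add_left inner_add_right power2_norm_eq_inner vform_def inner_commute
        mult.assoc)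
      (smt (verit) inner_ge_zero)
  also have "\<dots> \<le> norm (T + v) * norm p" unfolding T by (rule norm_cauchy_schwarz)
  also have "\<dots> \<le> (norm T + norm v) * norm p" by (intro mult_right_mono norm_triangle_ineq) simp
  finally have "dt * cm * norm p \<le> norm T + norm v"
    by (cases "norm p = 0") (auto simp: power2_eq_square)
  then have "(dt * cm * norm p)\<^sup>2 \<le> (norm T + norm v)\<^sup>2"
    using \<open>0 \<le> dt\<close> \<open>0 < cm\<close> by (intro power_mono) auto
  moreover have "cm * (norm T + norm v)\<^sup>2 \<le> cM * ((norm T)\<^sup>2 + ?s2)"
    using \<open>0 < cm\<close> \<open>cm \<le> cM\<close> v sigma0 by (intro weighted_square_add_le) auto
  ultimately show "cm * (dt * cm * norm p)\<^sup>2 \<le> cM * vform A z z"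
    using \<open>0 < cm\<close> unfolding zz power2_norm_eq_inner by (smt (verit) mult_left_mono)
qed

text \<open>
  The vector \<^term>\<open>n\<close> plays the part of the component of \<^term>\<open>u\<close> that the new angular basis misses.
  Being orthogonal to the range of \<^term>\<open>K\<close>, it removes the K-step solution from the Galerkin equation when
  the test matrix is \<open>outer n (E T)\<close>; adding \<open>outer n q\<close>, against which the old iterate vanishes,
  makes the old error alone bound \<^term>\<open>s * norm n\<close> times the square root of
  \<open>vform A z z\<close>, for the vector \<open>z\<close> of \<open>quadratic_overlap_bound\<close>.
\<close>

lemma K_step_error:
  fixes A B :: "real^'n^'n" and F0 :: "real^'n^'m" and E :: "real^'r^'n" and G K :: "real^'r^'m"
  assumes A: "psd_form (vform A)" and B: "psd_form (vform B)"
    and "0 < cm" and "cm \<le> cM" and lower: "\<And>v. cm * vform A v v \<le> vform B v v"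
    and upper: "\<And>v. vform B v v \<le> cM * vform A v v"
    and E_orth: "transpose E ** A ** E = mat 1"
    and p: "(transpose E ** B ** E) *v p = transpose E *v (B *v e)"
    and "0 \<le> \<alpha>" and "\<alpha> \<le> norm p" and "0 < dt" and "0 \<le> s"
    and F0: "F0 = G ** transpose E"
    and n_u: "n \<bullet> u = n \<bullet> n"
    and n_K: "\<And>c. n \<bullet> (K *v c) = 0"
    and step: "\<And>W. mform A (K ** transpose E - F0) (W ** transpose E)
        = dt * mform B (s *\<^sub>R outer u e - K ** transpose E) (W ** transpose E)"
  shows "\<alpha> * dt * cm * (s * norm n)
    \<le> sqrt (cM / cm) * sqrt (mform A (F0 - s *\<^sub>R outer u e) (F0 - s *\<^sub>R outer u e))"
proof -
  define T where "T = transpose E *v ((A + dt *\<^sub>R B) *v e)"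
  define z where "z = E *v T + (e - E *v (transpose E *v (A *v e)))"
  define q where "q = z - E *v T"
  define D where "D = F0 - s *\<^sub>R outer u e"
  define N where "N = vform A z z"
  note z_facts = quadratic_overlap_bound[OF A B \<open>0 < cm\<close> \<open>cm \<le> cM\<close> lower upper E_orth p _ T_def z_def]
  have N_lower: "cm * (dt * cm * norm p)\<^sup>2 \<le> cM * N"
    using z_facts(1) \<open>0 < dt\<close> by (simp add: N_def)
  have N: "N = T \<bullet> T + vform A e q"
    using z_facts(2) \<open>0 < dt\<close> by (simp add: N_def q_def)
  have Eq: "transpose E *v (A *v q) = 0"
    using z_facts(3) \<open>0 < dt\<close> by (simp add: q_def)
  have N0: "0 \<le> N" unfolding N_def by (rule psd_formD(8)[OF A])
  have mA: "psd_form (mform A :: real^'n^'m \<Rightarrow> _)" and mB: "psd_form (mform B :: real^'n^'m \<Rightarrow> _)"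
    using psd_mform A B by auto
  have K0: "mform C (K ** transpose E) (outer n g) = 0" for C :: "real^'n^'n" and g
    by (simp add: mform_outer_right matrix_vector_mul_assoc[symmetric] n_K)
  have "mform A D (outer n z) = - (s * (n \<bullet> n) * N)"
  proof -
    have "mform A D (outer n (E *v T)) = - (s * (n \<bullet> n) * (T \<bullet> T))"
    proof -
      have TT: "T \<bullet> T = vform A e (E *v T) + dt * vform B e (E *v T)"
        using vform_mult_vec_left[of "A + dt *\<^sub>R B" E T e] unfolding T_def[symmetric]
        by (simp add: vform_add_scaleR psd_formD(7)[OF A, of _ e] psd_formD(7)[OF B, of _ e])
      have "mform A F0 (outer n (E *v T)) = - dt * (s * (n \<bullet> n) * vform B e (E *v T))"
        using step[of "outer n T"]
        by (simp add: outer_mult_transpose psd_formD(3,5)[OF mA] psd_formD(3,5)[OF mB] K0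
            mform_outer_outer inner_commute[of u n] n_u)
      then show ?thesis
        unfolding D_def TT
        by (simp add: psd_formD(3,5)[OF mA] mform_outer_outer inner_commute[of u n] n_u
            distrib_left mult_ac)
    qed
    moreover have "mform A D (outer n q) = - (s * (n \<bullet> n) * vform A e q)"
    proof -
      \<comment> \<open>The rows of \<^term>\<open>F0\<close> lie in the column space of \<^term>\<open>E\<close>, to which \<^term>\<open>q\<close> is orthogonal.\<close>
      have "mform A F0 (outer n q) = 0"
        unfolding F0 by (simp add: mform_outer_right matrix_vector_mul_assoc[symmetric] Eq)
      then show ?thesis unfolding D_def
        by (simp add: psd_formD(3,5)[OF mA] mform_outer_outer inner_commute[of u n] n_u)
    qed
    moreover have "outer n z = outer n (E *v T) + outer n q"
      by (simp add: q_def vec_eq_iff outer_def algebra_simps)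
    ultimately show ?thesis by (simp add: psd_formD(2)[OF mA] N algebra_simps)
  qed
  then have "s * (n \<bullet> n) * N \<le> sqrt (mform A D D) * sqrt ((n \<bullet> n) * N)"
    using psd_form_Cauchy_Schwarz_sqrt[OF mA, of D "outer n z"]
    by (simp add: mform_outer_outer N_def)
  also have "\<dots> = sqrt (mform A D D) * (norm n * sqrt N)"
    by (simp add: real_sqrt_mult norm_eq_sqrt_inner)
  finally have "s * (n \<bullet> n) * N \<le> sqrt (mform A D D) * (norm n * sqrt N)" .
  moreover have "(s * norm n * sqrt N) * (norm n * sqrt N) = s * (n \<bullet> n) * N"
  proof -
    have "(s * norm n * sqrt N) * (norm n * sqrt N) = s * (norm n)\<^sup>2 * (sqrt N)\<^sup>2"
      by (simp only: power2_eq_square mult_ac)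
    then show ?thesis
      using N0 by (simp only: power2_norm_eq_inner real_sqrt_pow2)
  qed
  ultimately have "(s * norm n * sqrt N) * (norm n * sqrt N)
      \<le> sqrt (mform A D D) * (norm n * sqrt N)" by (simp only:)
  then have *: "s * norm n * sqrt N \<le> sqrt (mform A D D)"
    by (rule mult_right_le_imp_le') (use N0 psd_formD(8)[OF mA, of D] in auto)
  have "\<alpha> * dt * cm \<le> sqrt (cM / cm) * sqrt N"
  proof -
    have "(dt * cm * norm p)\<^sup>2 \<le> cM / cm * N"
      using N_lower \<open>0 < cm\<close> by (simp add: field_simps)
    then have "dt * cm * norm p \<le> sqrt (cM / cm * N)" by (rule real_le_rsqrt)
    moreover have "\<alpha> * dt * cm \<le> dt * cm * norm p"
      using \<open>\<alpha> \<le> norm p\<close> \<open>0 < dt\<close> \<open>0 < cm\<close> by (simp add: mult_ac)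
    ultimately show ?thesis by (simp only: real_sqrt_mult)
  qed
  then have "\<alpha> * dt * cm * (s * norm n) \<le> sqrt (cM / cm) * sqrt N * (s * norm n)"
    using \<open>0 \<le> s\<close> by (intro mult_right_mono) auto
  also have "\<dots> \<le> sqrt (cM / cm) * sqrt (mform A D D)"
    using mult_left_mono[OF *, of "sqrt (cM / cm)"] \<open>0 < cm\<close> \<open>cm \<le> cM\<close> by (simp add: mult_ac)
  finally show ?thesis unfolding D_def .
qed

text \<open>
  Dually, \<^term>\<open>e'\<close> plays the part of the component of \<^term>\<open>e\<close> that the new energy basis misses.  It is
  orthogonal to the range of \<^term>\<open>L\<close> in the form of \<^term>\<open>A\<close>, but the L-step equation is governed by
  \<open>M = A + dt B\<close>.  The test vector \<open>g\<close> with \<open>M g = A e'\<close> therefore replaces \<^term>\<open>e'\<close>; solving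
  with \<open>M\<close> shrinks it by \<open>1 + dt cm\<close>, which is the source of the factor \<^term>\<open>dt * cm\<close>.
\<close>

lemma L_step_error:
  fixes A B :: "real^'n^'n" and F0 :: "real^'n^'m" and U :: "real^'r^'m" and L :: "real^'r^'n"
  assumes A: "psd_form (vform A)" and B: "psd_form (vform B)"
    and A_definite: "\<And>v. vform A v v = 0 \<Longrightarrow> v = 0"
    and "0 < cm" and lower: "\<And>v. cm * vform A v v \<le> vform B v v"
    and U_orth: "transpose U ** U = mat 1"
    and "0 \<le> \<beta>" and \<beta>: "\<beta> \<le> norm (U *v (transpose U *v u))" and "0 < dt" and "0 \<le> s"
    and e'_e: "vform A e e' = vform A e' e'"
    and e'_L: "transpose L *v (A *v e') = 0"
    and step: "\<And>W. mform A (U ** transpose L - F0) (U ** transpose W)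
        = dt * mform B (s *\<^sub>R outer u e - U ** transpose L) (U ** transpose W)"
  shows "\<beta> * dt * cm * (s * sqrt (vform A e' e'))
    \<le> sqrt (mform A (F0 - s *\<^sub>R outer u e) (F0 - s *\<^sub>R outer u e))"
proof -
  define M where "M = A + dt *\<^sub>R B"
  have A0: "0 \<le> vform A v v" for v by (rule psd_formD(8)[OF A])
  have M_lower: "(1 + dt * cm) * vform A v v \<le> vform M v v" for v
    using mult_left_mono[OF lower[of v], of dt] \<open>0 < dt\<close>
    by (simp add: M_def vform_add_scaleR algebra_simps)
  have "\<exists>g. M *v g = A *v e'"
  proof -
    have "v = 0" if "M *v v = 0" for v
    proof -
      have "(1 + dt * cm) * vform A v v \<le> 0"
        using M_lower[of v] that by (simp add: vform_def)
      then have "vform A v v = 0"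
        using A0[of v] \<open>0 < dt\<close> \<open>0 < cm\<close> by (smt (verit) mult_pos_pos)
      then show ?thesis by (rule A_definite)
    qed
    then have "invertible M"
      by (metis invertible_left_inverse matrix_left_invertible_ker)
    then show ?thesis
      by (metis invertible_right_inverse matrix_vector_mul_assoc matrix_vector_mul_lid)
  qed
  then obtain g where g: "M *v g = A *v e'" by blast
  define d where "d = transpose U *v u"
  define D where "D = F0 - s *\<^sub>R outer u e"
  have mA: "psd_form (mform A :: real^'n^'m \<Rightarrow> _)" and mB: "psd_form (mform B :: real^'n^'m \<Rightarrow> _)"
    using psd_mform A B by auto
  have "vform M = (\<lambda>v w. vform A v w + dt * vform B v w)"
    by (simp add: fun_eq_iff M_def vform_add_scaleR)
  moreover have "psd_form (\<lambda>v w. vform A v w + dt * vform B v w)"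
    using psd_formD(8)[OF A] psd_formD(8)[OF B] \<open>0 < dt\<close> by (intro psd_form_add_scaled A B) auto
  ultimately have mM: "psd_form (mform M :: real^'n^'m \<Rightarrow> _)" by (simp add: psd_mform)
  have Ud_u: "u \<bullet> (U *v d) = d \<bullet> d"
    unfolding d_def by (metis dot_lmul_matrix transpose_matrix_vector)
  have U_iso: "(U *v d) \<bullet> (U *v d) = d \<bullet> d"
    by (metis U_orth dot_lmul_matrix matrix_vector_mul_assoc matrix_vector_mul_lid
        transpose_matrix_vector)
  have norm_d: "norm (U *v d) = norm d" by (simp add: norm_eq_sqrt_inner U_iso)
  let ?w = "outer (U *v d) g"
  have w: "?w = U ** transpose (outer g d)" by (simp add: mult_transpose_outer)
  have "mform M (U ** transpose L) ?w = 0"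
    by (simp add: mform_outer_right g matrix_vector_mul_assoc[symmetric] e'_L)
  moreover have "mform M (outer u e) ?w = (d \<bullet> d) * vform A e' e'"
    by (simp add: mform_outer_right g outer_mult_vec e'_e[unfolded vform_def] Ud_u[symmetric]
        inner_commute[of "U *v d"] vform_def)
  moreover have "mform M (U ** transpose L - s *\<^sub>R outer u e) ?w = mform A D ?w"
    using step[of "outer g d", folded w]
    by (simp add: M_def D_def mform_add_scaleR psd_formD(3,5)[OF mA] psd_formD(3,5)[OF mB]
        algebra_simps)
  ultimately have "mform A D ?w = - (s * (d \<bullet> d) * vform A e' e')"
    by (simp add: psd_formD(3,5)[OF mM])
  then have "s * (d \<bullet> d) * vform A e' e' \<le> sqrt (mform A D D) * sqrt ((d \<bullet> d) * vform A g g)"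
    using psd_form_Cauchy_Schwarz_sqrt[OF mA, of D ?w]
    by (simp add: mform_outer_outer U_iso)
  also have "\<dots> = sqrt (mform A D D) * (norm d * sqrt (vform A g g))"
    by (simp add: real_sqrt_mult norm_eq_sqrt_inner)
  also have "\<dots> * (dt * cm) \<le> sqrt (mform A D D) * (norm d * sqrt (vform A e' e'))"
  proof -
    let ?g = "sqrt (vform A g g)" and ?e = "sqrt (vform A e' e')"
    have "(1 + dt * cm) * (?g * ?g) \<le> vform A g e'"
      using M_lower[of g] A0[of g] g by (simp add: vform_def)
    also have "\<dots> \<le> ?g * ?e" using psd_form_Cauchy_Schwarz_sqrt[OF A, of g e'] by simp
    finally have "(1 + dt * cm) * ?g * ?g \<le> ?e * ?g" by (simp add: mult_ac)
    then have "(1 + dt * cm) * ?g \<le> ?e"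
      by (rule mult_right_le_imp_le') (use A0[of g] A0[of e'] in auto)
    moreover have "(1 + dt * cm) * ?g = ?g + dt * cm * ?g" by (simp only: distrib_right mult_1)
    moreover have "0 \<le> ?g" using A0[of g] by simp
    ultimately have "dt * cm * ?g \<le> ?e" by linarith
    then have "sqrt (mform A D D) * norm d * (dt * cm * ?g) \<le> sqrt (mform A D D) * norm d * ?e"
      using psd_formD(8)[OF mA] by (intro mult_left_mono) auto
    then show ?thesis by (simp add: mult_ac)
  qed
  finally have "s * (d \<bullet> d) * vform A e' e' * (dt * cm)
      \<le> sqrt (mform A D D) * (norm d * sqrt (vform A e' e'))"
    using \<open>0 < dt\<close> \<open>0 < cm\<close> by simp
  moreover have "(norm d * dt * cm * (s * sqrt (vform A e' e'))) * (norm d * sqrt (vform A e' e'))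
      = s * (d \<bullet> d) * vform A e' e' * (dt * cm)"
  proof -
    have "(norm d * dt * cm * (s * sqrt (vform A e' e'))) * (norm d * sqrt (vform A e' e'))
        = s * (norm d)\<^sup>2 * (sqrt (vform A e' e'))\<^sup>2 * (dt * cm)"
      by (simp only: power2_eq_square mult_ac)
    then show ?thesis using A0[of e'] by (simp only: power2_norm_eq_inner real_sqrt_pow2)
  qed
  ultimately have "(norm d * dt * cm * (s * sqrt (vform A e' e'))) * (norm d * sqrt (vform A e' e'))
      \<le> sqrt (mform A D D) * (norm d * sqrt (vform A e' e'))" by (simp only:)
  then have "norm d * dt * cm * (s * sqrt (vform A e' e')) \<le> sqrt (mform A D D)"
    by (rule mult_right_le_imp_le') (use A0[of e'] psd_formD(8)[OF mA, of D] in auto)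
  moreover have "\<beta> * dt * cm * (s * sqrt (vform A e' e'))
      \<le> norm d * dt * cm * (s * sqrt (vform A e' e'))"
    using \<beta> A0[of e'] \<open>0 < dt\<close> \<open>0 < cm\<close> \<open>0 \<le> s\<close>
    by (intro mult_right_mono) (auto simp: d_def[symmetric] norm_d)
  ultimately show ?thesis by (simp add: D_def)
qed

section \<open>Error of one step in coefficient form\<close>

text \<open>
  The equilibrium has rank one, so its projection \<open>V\<close> onto the new tensor space misses it by two mutually
  orthogonal pieces, one per factor.  Each is at most \<open>\<delta> / sqrt 2\<close> times the old error by the preceding two
  lemmas, and quasi-optimality in the new space concludes.
\<close>

lemma dlr_step_matrix_error:
  fixes A B :: "real^'n^'n" and F0 :: "real^'n^'m" and U U' K :: "real^'r^'m" and E E' L :: "real^'r^'n"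
    and S S' RK RL :: "real^'r^'r"
  assumes A: "psd_form (vform A)" and B: "psd_form (vform B)"
    and A_definite: "\<And>v. vform A v v = 0 \<Longrightarrow> v = 0"
    and "0 < cm" and "cm \<le> cM" and lower: "\<And>v. cm * vform A v v \<le> vform B v v"
    and upper: "\<And>v. vform B v v \<le> cM * vform A v v"
    and U_orth: "transpose U ** U = mat 1" and E_orth: "transpose E ** A ** E = mat 1"
    and U'_orth: "transpose U' ** U' = mat 1" and E'_orth: "transpose E' ** A ** E' = mat 1"
    and Feq: "Feq = s *\<^sub>R outer u e" and "u \<bullet> u = 1" and "vform A e e = 1" and "0 \<le> s"
    and p: "(transpose E ** B ** E) *v p = transpose E *v (B *v e)"
    and "0 < \<alpha>" and \<alpha>: "\<alpha> \<le> norm p"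
    and "0 < \<beta>" and \<beta>: "\<beta> \<le> norm (U *v (transpose U *v u))"
    and "0 < dt" and "0 < \<delta>"
    and dt_\<beta>: "sqrt 2 / \<delta> * (1 / (\<beta> * cm)) \<le> dt"
    and dt_\<alpha>: "sqrt 2 / \<delta> * (sqrt (cM / cm) / (\<alpha> * cm)) \<le> dt"
    and F0: "F0 = U ** S ** transpose E" and F1: "F1 = U' ** S' ** transpose E'"
    and K: "K = U' ** RK" and L: "L = E' ** RL"
    and K_step: "\<And>W. mform A (K ** transpose E - F0) (W ** transpose E)
        = dt * mform B (Feq - K ** transpose E) (W ** transpose E)"
    and L_step: "\<And>W. mform A (U ** transpose L - F0) (U ** transpose W)
        = dt * mform B (Feq - U ** transpose L) (U ** transpose W)"
    and S_step: "\<And>T. mform A (F1 - F0) (U' ** T ** transpose E')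
        = dt * mform B (Feq - F1) (U' ** T ** transpose E')"
  shows "sqrt (mform A (F1 - Feq) (F1 - Feq))
    \<le> (1 / (1 + dt * cm) + (1 + cM / cm) * \<delta>) * sqrt (mform A (F0 - Feq) (F0 - Feq))"
proof -
  have mA: "psd_form (mform A :: real^'n^'m \<Rightarrow> _)" and mB: "psd_form (mform B :: real^'n^'m \<Rightarrow> _)"
    using psd_mform A B by auto
  define u' where "u' = U' *v (transpose U' *v u)"
  define n where "n = u - u'"
  define e'' where "e'' = E' *v (transpose E' *v (A *v e))"
  define e' where "e' = e - e''"
  define D where "D = sqrt (mform A (F0 - Feq) (F0 - Feq))"
  have D0: "0 \<le> D" unfolding D_def using psd_formD(8)[OF mA] by simp
  have n_range: "n \<bullet> (U' *v c) = 0" for c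
  proof -
    have "transpose U' *v n = 0"
      by (simp add: n_def u'_def matrix_vector_mult_diff_distrib matrix_vector_mul_assoc
          matrix_mul_assoc U'_orth)
    then show ?thesis by (metis dot_lmul_matrix inner_zero_left transpose_matrix_vector)
  qed
  then have n_u': "n \<bullet> u' = 0" by (simp add: u'_def)
  then have n_u: "n \<bullet> u = n \<bullet> n" by (simp add: n_def inner_diff_right)
  have "u \<bullet> u = n \<bullet> n + u' \<bullet> u'"
    using n_u' by (simp add: n_def inner_diff_right inner_diff_left inner_commute)
  then have u'1: "u' \<bullet> u' \<le> 1" using \<open>u \<bullet> u = 1\<close> inner_ge_zero[of n] by linarith
  have E'_e': "transpose E' *v (A *v e') = 0"
    by (simp add: e'_def e''_def matrix_vector_mult_diff_distrib matrix_vector_mul_assoc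
          matrix_mul_assoc E'_orth)
  then have "vform A e'' e' = 0" by (simp add: e''_def vform_mult_vec_left)
  then have e'_e: "vform A e e' = vform A e' e'" by (simp add: e'_def psd_formD(3)[OF A])
  have K_err: "\<alpha> * dt * cm * (s * norm n) \<le> sqrt (cM / cm) * D"
    unfolding D_def Feq
    by (rule K_step_error[OF A B \<open>0 < cm\<close> \<open>cm \<le> cM\<close> lower upper E_orth p _ \<alpha> \<open>0 < dt\<close> \<open>0 \<le> s\<close> F0 n_u _
          K_step[unfolded Feq]])
      (use \<open>0 < \<alpha>\<close> in \<open>auto simp: K n_range matrix_vector_mul_assoc[symmetric]\<close>)
  have L_err: "\<beta> * dt * cm * (s * sqrt (vform A e' e')) \<le> D"
    unfolding D_def Feq
    by (rule L_step_error[OF A B A_definite \<open>0 < cm\<close> lower U_orth _ \<beta> \<open>0 < dt\<close> \<open>0 \<le> s\<close> e'_e _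
          L_step[unfolded Feq]])
      (use \<open>0 < \<beta>\<close> in \<open>auto simp: L E'_e' matrix_transpose_mul matrix_vector_mul_assoc[symmetric]\<close>)
  have n_bound: "s * norm n \<le> \<delta> / sqrt 2 * D"
  proof -
    have "sqrt 2 * sqrt (cM / cm) \<le> \<delta> * (\<alpha> * dt * cm)"
      using dt_\<alpha> \<open>0 < \<alpha>\<close> \<open>0 < cm\<close> \<open>0 < \<delta>\<close> by (simp add: divide_le_eq mult_ac)
    then have "sqrt 2 * sqrt (cM / cm) * D \<le> \<delta> * (\<alpha> * dt * cm) * D"
      using D0 by (intro mult_right_mono)
    moreover have "sqrt 2 * (\<alpha> * dt * cm * (s * norm n)) \<le> sqrt 2 * (sqrt (cM / cm) * D)"
      using K_err by (intro mult_left_mono) auto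
    ultimately have "(\<alpha> * dt * cm) * (sqrt 2 * (s * norm n)) \<le> (\<alpha> * dt * cm) * (\<delta> * D)"
      by (simp only: mult_ac)
    then have "sqrt 2 * (s * norm n) \<le> \<delta> * D"
      using \<open>0 < \<alpha>\<close> \<open>0 < cm\<close> \<open>0 < dt\<close> by simp
    then show ?thesis by (simp add: field_simps)
  qed
  have e'_bound: "s * sqrt (vform A e' e') \<le> \<delta> / sqrt 2 * D"
  proof -
    have "sqrt 2 \<le> \<delta> * (\<beta> * dt * cm)"
      using dt_\<beta> \<open>0 < \<beta>\<close> \<open>0 < cm\<close> \<open>0 < \<delta>\<close> by (simp add: divide_le_eq mult_ac)
    then have "sqrt 2 * D \<le> \<delta> * (\<beta> * dt * cm) * D"
      using D0 by (intro mult_right_mono)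
    moreover have "sqrt 2 * (\<beta> * dt * cm * (s * sqrt (vform A e' e'))) \<le> sqrt 2 * D"
      using L_err by (intro mult_left_mono) auto
    ultimately have "(\<beta> * dt * cm) * (sqrt 2 * (s * sqrt (vform A e' e'))) \<le> (\<beta> * dt * cm) * (\<delta> * D)"
      by (simp only: mult_ac)
    then have "sqrt 2 * (s * sqrt (vform A e' e')) \<le> \<delta> * D"
      using \<open>0 < \<beta>\<close> \<open>0 < cm\<close> \<open>0 < dt\<close> by simp
    then show ?thesis by (simp add: field_simps)
  qed
  define V where "V = s *\<^sub>R outer u' e''"
  have V: "V = U' ** outer (s *\<^sub>R (transpose U' *v u)) (transpose E' *v (A *v e)) ** transpose E'"
    by (simp only: V_def u'_def e''_def mult_outer matrix_vector_mult_scaleR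
        outer_scaleR_left[symmetric] outer_mult_transpose)
  have "mform A (V - Feq) (V - Feq) \<le> (\<delta> * D)\<^sup>2"
  proof -
    have "mform A (outer n e + outer u' e') (outer n e + outer u' e')
        = n \<bullet> n + (u' \<bullet> u') * vform A e' e'"
      using n_u' \<open>vform A e e = 1\<close>
      by (simp add: psd_formD(1,2)[OF mA] mform_outer_outer inner_commute[of u' n])
    moreover have "V - Feq = (- s) *\<^sub>R (outer n e + outer u' e')"
      by (simp add: V_def Feq n_def e'_def vec_eq_iff outer_def algebra_simps)
    ultimately have "mform A (V - Feq) (V - Feq) = s\<^sup>2 * (n \<bullet> n + (u' \<bullet> u') * vform A e' e')"
      by (simp only: psd_formD(5,6)[OF mA] power2_eq_square mult.assoc mult_minus_left mult_minus_right
          minus_minus)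
    also have "\<dots> \<le> s\<^sup>2 * (n \<bullet> n + 1 * vform A e' e')"
      using u'1 psd_formD(8)[OF A] by (intro mult_left_mono add_left_mono mult_right_mono) auto
    also have "\<dots> = (s * norm n)\<^sup>2 + (s * sqrt (vform A e' e'))\<^sup>2"
      using psd_formD(8)[OF A] by (simp add: power_mult_distrib power2_norm_eq_inner algebra_simps)
    also have "\<dots> \<le> (\<delta> / sqrt 2 * D)\<^sup>2 + (\<delta> / sqrt 2 * D)\<^sup>2"
      using n_bound e'_bound \<open>0 \<le> s\<close> psd_formD(8)[OF A] by (intro add_mono power_mono) auto
    also have "\<dots> = (\<delta> * D)\<^sup>2" by (simp add: power_mult_distrib power_divide)
    finally show ?thesis .
  qed
  then have V_err: "sqrt (mform A (V - Feq) (V - Feq)) \<le> \<delta> * D"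
    using \<open>0 < \<delta>\<close> D0 by (intro real_le_lsqrt) auto
  define M where "M = (\<lambda>F G :: real^'n^'m. mform A F G + dt * mform B F G)"
  have mform_lower: "cm * mform A F F \<le> mform B F F"
    and mform_upper: "mform B F F \<le> cM * mform A F F" for F :: "real^'n^'m"
    unfolding mform_def sum_distrib_left by (auto intro!: sum_mono lower upper)
  have "sqrt (mform A (F1 - Feq) (F1 - Feq)) \<le> 1 / (1 + dt * cm) * D
      + (1 + (1 + dt * cM) / (1 + dt * cm)) * sqrt (mform A (V - Feq) (V - Feq))"
    unfolding D_def
  proof (rule galerkin_quasi_optimality[OF mA, where B = M])
    show "psd_form M"
      unfolding M_def using psd_formD(8)[OF mA] psd_formD(8)[OF mB] \<open>0 < dt\<close>
      by (intro psd_form_add_scaled mA mB) auto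
    show "(1 + dt * cm) * mform A F F \<le> M F F" for F
      using mult_left_mono[OF mform_lower[of F], of dt] \<open>0 < dt\<close> by (simp add: M_def algebra_simps)
    show "M F F \<le> (1 + dt * cM) * mform A F F" for F
      using mult_left_mono[OF mform_upper[of F], of dt] \<open>0 < dt\<close> by (simp add: M_def algebra_simps)
    have "\<exists>T. F1 - V = U' ** T ** transpose E'"
    proof -
      have "U' ** (X - Y) ** transpose E' = U' ** X ** transpose E' - U' ** Y ** transpose E'" for X Y
        by (simp add: matrix_diff_ldistrib matrix_diff_rdistrib)
      then show ?thesis unfolding F1 V by metis
    qed
    then obtain T where "F1 - V = U' ** T ** transpose E'" by blast
    then have "mform A (F1 - F0) (F1 - V) = dt * mform B (Feq - F1) (F1 - V)"
      using S_step[of T] by simp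
    then show "M (F1 - Feq) (F1 - V) = mform A (F0 - Feq) (F1 - V)"
      unfolding M_def by (simp add: psd_formD(3)[OF mA] psd_formD(3)[OF mB] algebra_simps)
  qed (use \<open>0 < cm\<close> \<open>cm \<le> cM\<close> \<open>0 < dt\<close> in \<open>auto intro: add_pos_pos\<close>)
  also have "\<dots> \<le> 1 / (1 + dt * cm) * D + (1 + cM / cm) * (\<delta> * D)"
  proof -
    have "(1 + dt * cM) / (1 + dt * cm) \<le> cM / cm"
      using \<open>0 < cm\<close> \<open>cm \<le> cM\<close> \<open>0 < dt\<close> by (simp add: pos_divide_le_eq add_pos_pos) (simp add: field_simps)
    then show ?thesis
      using V_err psd_formD(8)[OF mA] \<open>0 < cm\<close> \<open>cm \<le> cM\<close>
      by (intro add_left_mono mult_mono) auto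
  qed
  finally show ?thesis by (simp add: D_def algebra_simps)
qed

section \<open>Legendre polynomials\<close>

lemma degree_legendre: "degree (legendre j) = j"
proof -
  have "degree ([:-1, 0, 1:] ^ j :: real poly) = 2 * j"
    by (simp add: degree_power_eq)
  then show ?thesis by (simp add: legendre_def degree_higher_pderiv)
qed

lemma power_dvd_higher_pderiv:
  fixes p :: "'a::idom poly"
  assumes "l \<le> j"
  shows "p ^ (j - l) dvd (pderiv ^^ l) (p ^ j)"
  using assms
proof (induction l)
  case (Suc l)
  then obtain q where q: "(pderiv ^^ l) (p ^ j) = p ^ Suc (j - Suc l) * q"
    by (metis Suc_diff_Suc Suc_leD Suc_le_lessD dvdE)
  have "(pderiv ^^ Suc l) (p ^ j) = p ^ (j - Suc l) *
      (p * pderiv q + q * smult (of_nat (Suc (j - Suc l))) (pderiv p))"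
    by (simp add: q pderiv_mult pderiv_power_Suc del: power_Suc of_nat_Suc) (simp add: algebra_simps)
  then show ?case by (simp only: dvd_triv_left)
qed simp

lemma poly_FTC:
  fixes p :: "real poly"
  assumes "a \<le> b"
  shows "((\<lambda>s. poly (pderiv p) s) has_integral (poly p b - poly p a)) {a..b}"
  using assms
  by (intro fundamental_theorem_of_calculus)
    (auto simp: has_real_derivative_iff_has_vector_derivative[symmetric] intro: DERIV_subset[OF poly_DERIV])

text \<open>
  Integration by parts: the boundary terms vanish because \<open>X\<^sup>2 - 1\<close> divides every derivative of
  \<open>(X\<^sup>2 - 1)\<^sup>j\<close> of order below \<^term>\<open>j\<close>, and each step lowers the degree of \<^term>\<open>q\<close>.
\<close>

lemma higher_pderiv_legendre_orthogonal:
  fixes q :: "real poly"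
  assumes "i \<le> j" "degree q < i"
  shows "((\<lambda>s. poly ((pderiv ^^ i) ([:-1, 0, 1:] ^ j)) s * poly q s) has_integral 0) {-1..1}"
  using assms
proof (induction i arbitrary: q)
  case (Suc i)
  let ?g = "(pderiv ^^ i) ([:-1, 0, 1:] ^ j) :: real poly"
  have "[:-1, 0, 1:] dvd ([:-1, 0, 1:] :: real poly) ^ (j - i)"
    using Suc.prems by (intro dvd_power) simp
  also have "\<dots> dvd ?g"
    using Suc.prems by (intro power_dvd_higher_pderiv) simp
  finally obtain h where h: "?g = [:-1, 0, 1:] * h" by (rule dvdE)
  have zero: "poly ?g 1 = 0" "poly ?g (-1) = 0" unfolding h by simp_all
  have "((\<lambda>s. poly (pderiv (?g * q)) s) has_integral 0) {-1..1}"
    using poly_FTC[of "-1" 1 "?g * q"] zero by simp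
  moreover have "((\<lambda>s. poly ?g s * poly (pderiv q) s) has_integral 0) {-1..1}"
  proof (cases "degree q = 0")
    case True
    then have "pderiv q = 0" by (simp add: pderiv_eq_0_iff)
    then show ?thesis by simp
  next
    case False
    then show ?thesis using Suc.prems by (intro Suc.IH) (auto simp: degree_pderiv)
  qed
  ultimately have "((\<lambda>s. poly (pderiv (?g * q)) s - poly ?g s * poly (pderiv q) s)
      has_integral 0 - 0) {-1..1}"
    by (rule has_integral_diff)
  then show ?case by (simp add: pderiv_mult mult.commute)
qed simp

lemma legendre_orthogonal:
  assumes "i \<noteq> j"
  shows "((\<lambda>s. poly (legendre i) s * poly (legendre j) s) has_integral 0) {-1..1}"
proof -
  have *: "((\<lambda>s. poly (legendre j) s * poly (legendre i) s) has_integral 0) {-1..1}" if "i < j" for i j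
    using has_integral_mult_right[OF higher_pderiv_legendre_orthogonal[of j j "legendre i"],
        of "1 / (2 ^ j * fact j)"] that
    by (simp add: degree_legendre legendre_def[of j] mult.assoc)
  show ?thesis
    using *[of i j] *[of j i] assms by (cases i j rule: linorder_cases) (auto simp: mult.commute)
qed

definition scaled_legendre :: "real \<Rightarrow> real \<Rightarrow> nat \<Rightarrow> real poly" where
  "scaled_legendre a b j = pcompose (legendre j) [:- (a + b) / (b - a), 2 / (b - a):]"

lemma poly_scaled_legendre:
  "poly (scaled_legendre a b j) s = poly (legendre j) ((2 * s - a - b) / (b - a))"
proof -
  have "- (a + b) / (b - a) + s * (2 / (b - a)) = (2 * s - a - b) / (b - a)"
    by (simp add: add_divide_distrib diff_divide_distrib)
  then show ?thesis by (simp add: scaled_legendre_def poly_pcompose)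
qed

lemma degree_scaled_legendre: "a < b \<Longrightarrow> degree (scaled_legendre a b j) = j"
  by (simp add: scaled_legendre_def degree_pcompose degree_legendre)

lemma scaled_legendre_nonzero:
  assumes "a < b"
  shows "scaled_legendre a b j \<noteq> 0"
proof -
  have "legendre j \<noteq> 0"
    using degree_legendre[of j] by (cases j) (auto simp: legendre_def)
  then show ?thesis using assms by (simp add: scaled_legendre_def pcompose_eq_0_iff)
qed

lemma LINT_eq_has_integral:
  fixes f :: "real \<Rightarrow> real"
  assumes "continuous_on {a..b} f" "(f has_integral I) {a..b}"
  shows "(LINT s|lebesgue_on {a..b}. f s) = I"
  using has_integral_integral_lebesgue_on[OF continuous_imp_integrable_real[OF assms(1)]] assms(2)
  by (simp add: has_integral_unique)

lemma scaled_legendre_orthogonal: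
  assumes "a < b" "i \<noteq> j"
  shows "(LINT s|lebesgue_on {a..b}. poly (scaled_legendre a b i) s * poly (scaled_legendre a b j) s) = 0"
proof (rule LINT_eq_has_integral)
  define m where "m = 2 / (b - a)"
  define c where "c = - (a + b) / (b - a)"
  have "m > 0" using assms by (simp add: m_def)
  have endpoints: "(-1 - c) /\<^sub>R m = a" "(1 - c) /\<^sub>R m = b"
    using assms by (simp_all add: m_def c_def field_simps)
  have "((\<lambda>s. poly (legendre i) (m *\<^sub>R s + c) * poly (legendre j) (m *\<^sub>R s + c)) has_integral 0 /\<^sub>R m ^ DIM(real))
      (cbox ((-1 - c) /\<^sub>R m) ((1 - c) /\<^sub>R m))"
    using legendre_orthogonal[OF assms(2)]
    by (intro has_integral_affinity'[OF _ \<open>m > 0\<close>, of "\<lambda>s. poly (legendre i) s * poly (legendre j) s"]) simp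
  then have "((\<lambda>s. poly (legendre i) (m * s + c) * poly (legendre j) (m * s + c)) has_integral 0) {a..b}"
    unfolding endpoints by simp
  moreover have "poly (scaled_legendre a b l) s = poly (legendre l) (m * s + c)" for l s
    unfolding scaled_legendre_def poly_pcompose m_def[symmetric] c_def[symmetric]
    by (simp add: algebra_simps)
  ultimately show "((\<lambda>s. poly (scaled_legendre a b i) s * poly (scaled_legendre a b j) s) has_integral 0) {a..b}"
    by simp
qed (rule continuous_on_mult; rule continuous_on_poly; rule continuous_on_id)

lemma scaled_legendre_square_pos:
  assumes "a < b"
  shows "(LINT s|lebesgue_on {a..b}. (poly (scaled_legendre a b j) s)\<^sup>2) > 0"
proof -
  let ?f = "\<lambda>s. (poly (scaled_legendre a b j) s)\<^sup>2"
  have cont: "continuous_on {a..b} ?f" by (rule continuous_on_power; rule continuous_on_poly; rule continuous_on_id)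
  have eq: "(LINT s|lebesgue_on {a..b}. ?f s) = integral {a..b} ?f"
    by (intro lebesgue_integral_eq_integral continuous_imp_integrable_real cont) simp
  have "integral {a..b} ?f \<noteq> 0"
  proof
    assume "integral {a..b} ?f = 0"
    then have "\<forall>s\<in>{a..b}. poly (scaled_legendre a b j) s = 0"
      using integral_eq_0_iff[OF cont assms] by simp
    then have "{a..b} \<subseteq> {s. poly (scaled_legendre a b j) s = 0}" by auto
    moreover have "infinite {a..b}" using assms by (simp add: infinite_Icc)
    ultimately have "scaled_legendre a b j = 0" using poly_roots_finite finite_subset by blast
    then show False using scaled_legendre_nonzero[OF assms] by simp
  qed
  moreover have "0 \<le> integral {a..b} ?f"
    unfolding eq[symmetric] by (intro Bochner_Integration.integral_nonneg) simp
  ultimately show ?thesis unfolding eq by simp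
qed

text \<open>
  Subtract a multiple of the polynomial of top degree and induct.
\<close>

lemma poly_span_of_degrees:
  fixes q :: "nat \<Rightarrow> real poly"
  assumes "\<And>j. degree (q j) = j" and "q 0 \<noteq> 0" and "degree p \<le> k"
  shows "\<exists>c. p = (\<Sum>j\<le>k. smult (c j) (q j))"
  using assms(3)
proof (induction k arbitrary: p)
  case 0
  then obtain a where "p = [:a:]" by (metis degree_0_id gr0I le_zero_eq)
  moreover obtain b where "q 0 = [:b:]" "b \<noteq> 0"
    using assms(1)[of 0] assms(2) by (metis degree_0_id pCons_0_0)
  ultimately have "p = smult (a / b) (q 0)" by simp
  then show ?case by (intro exI[of _ "\<lambda>_. a / b"]) simp
next
  case (Suc k)
  define c where "c = coeff p (Suc k) / coeff (q (Suc k)) (Suc k)"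
  have "coeff (q (Suc k)) (Suc k) \<noteq> 0"
    using assms(1)[of "Suc k"] by (metis degree_0 leading_coeff_0_iff nat.distinct(1))
  then have "coeff (p - smult c (q (Suc k))) (Suc k) = 0" by (simp add: c_def)
  moreover have "degree (p - smult c (q (Suc k))) \<le> Suc k"
    using Suc.prems assms(1)[of "Suc k"] by (intro degree_diff_le) (auto intro: order_trans[OF degree_smult_le])
  ultimately have "degree (p - smult c (q (Suc k))) \<le> k"
    by (metis degree_0 le_SucE leading_coeff_0_iff zero_le)
  then obtain d where "p - smult c (q (Suc k)) = (\<Sum>j\<le>k. smult (d j) (q j))" using Suc.IH by blast
  then have "p = (\<Sum>j\<le>Suc k. smult ((d(Suc k := c)) j) (q j))" by (simp add: algebra_simps)
  then show ?case by blast
qed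

section \<open>The orthonormal cell basis\<close>

lemma partition_of_less:
  assumes "partition_of a b N t" "i < j" "j \<le> N"
  shows "t i < t j"
  using assms(2,3)
proof (induction j)
  case (Suc j)
  then have "t j < t (Suc j)" using assms(1) by (simp add: partition_of_def)
  then show ?case using Suc by (cases "i = j") auto
qed simp

lemma partition_of_mono:
  assumes "partition_of a b N t" "i \<le> j" "j \<le> N"
  shows "t i \<le> t j"
  using partition_of_less[OF assms(1), of i j] assms by (cases "i = j") auto

lemma cell_subset: "cell N t i \<subseteq> {t i..t (Suc i)}"
  by (auto simp: cell_def)

lemma cell_subset_interval:
  assumes "partition_of a b N t" "i < N"
  shows "{t i..t (Suc i)} \<subseteq> {a..b}"
  using partition_of_mono[OF assms(1), of 0 i] partition_of_mono[OF assms(1), of "Suc i" N] assms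
  by (auto simp: partition_of_def)

lemma disjoint_cells:
  assumes "partition_of a b N t" "i < N" "j < N" "i \<noteq> j"
  shows "cell N t i \<inter> cell N t j = {}"
proof -
  have *: "cell N t i \<inter> cell N t j = {}" if "i < j" "j < N" for i j
    using partition_of_mono[OF assms(1), of "Suc i" j] that by (auto simp: cell_def)
  show ?thesis using *[of i j] *[of j i] assms by (cases i j rule: linorder_cases) auto
qed

lemma cell_measurable [measurable]: "cell N t i \<in> sets borel"
  by (auto simp: cell_def)

text \<open>
  The half-open cell and its closure differ by a single point.
\<close>

lemma LINT_cell:
  fixes g :: "real \<Rightarrow> real"
  assumes [measurable]: "g \<in> borel_measurable borel" and S: "{t i..t (Suc i)} \<subseteq> {a..b}"
  shows "(LINT s|lebesgue_on {a..b}. indicator (cell N t i) s * g s)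
    = (LINT s|lebesgue_on {t i..t (Suc i)}. g s)"
proof -
  have "(LINT s|lebesgue_on {a..b}. indicator (cell N t i) s * g s)
      = (LINT s|lebesgue. indicator {a..b} s *\<^sub>R (indicator (cell N t i) s * g s))"
    by (simp add: integral_restrict_space)
  also have "\<dots> = (LINT s|lebesgue. indicator {t i..t (Suc i)} s *\<^sub>R g s)"
  proof (rule integral_cong_AE)
    have "AE s in lebesgue. s \<noteq> t (Suc i)"
      by (rule AE_completion) (rule AE_lborel_singleton)
    then show "AE s in lebesgue. indicator {a..b} s *\<^sub>R (indicator (cell N t i) s * g s)
        = indicator {t i..t (Suc i)} s *\<^sub>R g s"
    proof eventually_elim
      case (elim s)
      then have "s \<in> cell N t i \<longleftrightarrow> s \<in> {t i..t (Suc i)}" by (auto simp: cell_def)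
      then show ?case using S by (auto simp: indicator_def)
    qed
  qed (measurable, auto intro!: measurable_completion)
  also have "\<dots> = (LINT s|lebesgue_on {t i..t (Suc i)}. g s)"
    by (simp add: integral_restrict_space)
  finally show ?thesis .
qed

definition cell_norm :: "(nat \<Rightarrow> real) \<Rightarrow> nat \<Rightarrow> nat \<Rightarrow> real" where
  "cell_norm t i j =
     sqrt (LINT s|lebesgue_on {t i..t (Suc i)}. (poly (scaled_legendre (t i) (t (Suc i)) j) s)\<^sup>2)"

lemma cell_norm_pos: "t i < t (Suc i) \<Longrightarrow> cell_norm t i j > 0"
  by (simp add: cell_norm_def scaled_legendre_square_pos)

lemma poly_borel_measurable [measurable]: "poly (p :: real poly) \<in> borel_measurable borel"
  by (intro borel_measurable_continuous_onI continuous_intros)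

lemma cell_legendre_normalized_eq:
  "cell_legendre_normalized N t i j s =
    indicator (cell N t i) s * poly (scaled_legendre (t i) (t (Suc i)) j) s / cell_norm t i j"
proof -
  have "(LINT u|lebesgue_on {t i..t (Suc i)}. (cell_legendre N t i j u)\<^sup>2)
      = (LINT u|lebesgue_on {t i..t (Suc i)}. indicator (cell N t i) u *
          (poly (scaled_legendre (t i) (t (Suc i)) j) u)\<^sup>2)"
    by (auto intro!: Bochner_Integration.integral_cong
        simp: cell_legendre_def poly_scaled_legendre indicator_def)
  also have "\<dots> = (LINT u|lebesgue_on {t i..t (Suc i)}. (poly (scaled_legendre (t i) (t (Suc i)) j) u)\<^sup>2)"
    by (rule LINT_cell) auto
  finally show ?thesis
    by (simp add: cell_legendre_normalized_def cell_norm_def cell_legendre_def poly_scaled_legendre)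
qed

lemma legendre_basis_orthonormal:
  assumes P: "partition_of a b N t" and x: "legendre_basis k N t x"
  shows "(LINT s|lebesgue_on {a..b}. x i s * x j s) = (if i = j then 1 else 0)"
proof -
  obtain \<sigma> where \<sigma>: "bij_betw \<sigma> UNIV ({..<N} \<times> {..k})"
    and x_eq: "\<And>i. x i = cell_legendre_normalized N t (fst (\<sigma> i)) (snd (\<sigma> i))"
    using x unfolding legendre_basis_def by blast
  obtain c l where i: "\<sigma> i = (c, l)" by (cases "\<sigma> i")
  obtain d m where j: "\<sigma> j = (d, m)" by (cases "\<sigma> j")
  have "c < N" "d < N"
    using bij_betwE[OF \<sigma>] i j by (metis UNIV_I mem_Sigma_iff lessThan_iff)+
  show ?thesis
  proof (cases "c = d")
    case False
    then have "s \<notin> cell N t c \<or> s \<notin> cell N t d" for s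
      using disjoint_cells[OF P \<open>c < N\<close> \<open>d < N\<close>] by blast
    then have "(\<lambda>s. x i s * x j s) = (\<lambda>s. 0)"
      by (force simp: x_eq i j cell_legendre_normalized_eq indicator_def)
    moreover have "i \<noteq> j" using False i j by auto
    ultimately show ?thesis by (simp only: if_False) simp
  next
    case True
    let ?p = "scaled_legendre (t c) (t (Suc c))"
    have less: "t c < t (Suc c)" using P \<open>c < N\<close> by (simp add: partition_of_def)
    have "x i s * x j s = indicator (cell N t c) s *
        (poly (?p l) s * poly (?p m) s / (cell_norm t c l * cell_norm t c m))" for s
      by (simp add: x_eq i j True cell_legendre_normalized_eq indicator_def)
    then have "(LINT s|lebesgue_on {a..b}. x i s * x j s)
        = (LINT s|lebesgue_on {t c..t (Suc c)}. poly (?p l) s * poly (?p m) s / (cell_norm t c l * cell_norm t c m))"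
      by (simp only:) (intro LINT_cell cell_subset_interval[OF P \<open>c < N\<close>], measurable)
    also have "\<dots> = (LINT s|lebesgue_on {t c..t (Suc c)}. poly (?p l) s * poly (?p m) s)
        / (cell_norm t c l * cell_norm t c m)" by simp
    also have "\<dots> = (if l = m then 1 else 0)"
    proof (cases "l = m")
      case True
      have "(cell_norm t c m)\<^sup>2 = (LINT s|lebesgue_on {t c..t (Suc c)}. (poly (?p m) s)\<^sup>2)"
        using scaled_legendre_square_pos[OF less, of m] by (simp add: cell_norm_def)
      then show ?thesis
        using scaled_legendre_square_pos[OF less, of m] True
        by (simp flip: power2_eq_square)
    next
      case False
      then show ?thesis using scaled_legendre_orthogonal[OF less False] by simp
    qed
    also have "l = m \<longleftrightarrow> i = j"
    proof -
      have "inj \<sigma>" using \<sigma> by (simp add: bij_betw_def)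
      then show ?thesis using i j True by (metis injD prod.inject)
    qed
    finally show ?thesis .
  qed
qed

lemma legendre_basis_measurable:
  assumes "legendre_basis k N t x"
  shows "x i \<in> borel_measurable borel"
proof -
  obtain \<sigma> :: "_ \<Rightarrow> nat \<times> nat" where "\<And>i. x i = cell_legendre_normalized N t (fst (\<sigma> i)) (snd (\<sigma> i))"
    using assms unfolding legendre_basis_def by blast
  moreover have "cell_legendre_normalized N t c l \<in> borel_measurable borel" for c l
    unfolding cell_legendre_normalized_eq[abs_def] by measurable
  ultimately show ?thesis by simp
qed

lemma legendre_basis_bounded:
  assumes "legendre_basis k N t x"
  shows "\<exists>C. \<forall>s. \<bar>x i s\<bar> \<le> C"
proof -
  obtain \<sigma> :: "_ \<Rightarrow> nat \<times> nat" where x: "\<And>i. x i = cell_legendre_normalized N t (fst (\<sigma> i)) (snd (\<sigma> i))"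
    using assms unfolding legendre_basis_def by blast
  let ?c = "fst (\<sigma> i)" and ?l = "snd (\<sigma> i)"
  let ?q = "\<lambda>s. poly (scaled_legendre (t ?c) (t (Suc ?c)) ?l) s * (1 / cell_norm t ?c ?l)"
  have "continuous_on {t ?c..t (Suc ?c)} ?q"
    by (rule continuous_on_mult[OF continuous_on_poly[OF continuous_on_id] continuous_on_const])
  then have "bounded (?q ` {t ?c..t (Suc ?c)})"
    by (intro compact_imp_bounded compact_continuous_image compact_Icc)
  then obtain C where C: "\<And>s. s \<in> {t ?c..t (Suc ?c)} \<Longrightarrow> \<bar>?q s\<bar> \<le> C"
    unfolding bounded_real by blast
  have "\<bar>x i s\<bar> \<le> max C 0" for s
    using C[of s] cell_subset[of N t ?c] by (auto simp: x cell_legendre_normalized_eq indicator_def)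
  then show ?thesis by blast
qed

text \<open>
  The polynomials of the basis on a fixed cell have degrees \<open>0, ..., k\<close>.
\<close>

lemma legendre_basis_spans:
  fixes x :: "'i::finite \<Rightarrow> real \<Rightarrow> real"
  assumes P: "partition_of a b N t" and x: "legendre_basis k N t x" and v: "v \<in> pw_poly k N t"
  shows "\<exists>c. v = (\<lambda>s. \<Sum>i\<in>UNIV. c i * x i s)"
proof -
  obtain p where p: "\<And>i. i < N \<Longrightarrow> degree (p i) \<le> k"
    and v_eq: "v = (\<lambda>s. \<Sum>i<N. indicator (cell N t i) s * poly (p i) s)"
    using v unfolding pw_poly_def by blast
  obtain \<sigma> where \<sigma>: "bij_betw \<sigma> UNIV ({..<N} \<times> {..k})"
    and x_eq: "\<And>i. x i = cell_legendre_normalized N t (fst (\<sigma> i)) (snd (\<sigma> i))"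
    using x unfolding legendre_basis_def by blast
  have less: "t i < t (Suc i)" if "i < N" for i using P that by (simp add: partition_of_def)
  have "\<exists>c. p i = (\<Sum>j\<le>k. smult (c j) (scaled_legendre (t i) (t (Suc i)) j))" if "i < N" for i
    using less[OF that] p[OF that] degree_scaled_legendre
    by (intro poly_span_of_degrees) (auto simp: scaled_legendre_nonzero)
  then obtain c where c: "\<And>i. i < N \<Longrightarrow> p i = (\<Sum>j\<le>k. smult (c i j) (scaled_legendre (t i) (t (Suc i)) j))"
    by metis
  let ?g = "\<lambda>s z. (c (fst z) (snd z) * cell_norm t (fst z) (snd z)) * cell_legendre_normalized N t (fst z) (snd z) s"
  have "v s = (\<Sum>i\<in>UNIV. c (fst (\<sigma> i)) (snd (\<sigma> i)) * cell_norm t (fst (\<sigma> i)) (snd (\<sigma> i)) * x i s)" for s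
  proof -
    have "v s = (\<Sum>i<N. \<Sum>j\<le>k. ?g s (i, j))"
    proof (unfold v_eq, intro sum.cong refl)
      fix i assume "i \<in> {..<N}"
      then have "i < N" by simp
      then show "indicator (cell N t i) s * poly (p i) s = (\<Sum>j\<le>k. ?g s (i, j))"
      proof -
        have nonzero: "cell_norm t i j \<noteq> 0" for j
          using cell_norm_pos[of t i j] less[OF \<open>i < N\<close>] by simp
        have "indicator (cell N t i) s * poly (p i) s
            = (\<Sum>j\<le>k. indicator (cell N t i) s * (c i j * poly (scaled_legendre (t i) (t (Suc i)) j) s))"
          by (simp add: c[OF \<open>i < N\<close>] poly_sum sum_distrib_left)
        also have "\<dots> = (\<Sum>j\<le>k. ?g s (i, j))"
          by (intro sum.cong refl) (simp add: cell_legendre_normalized_eq nonzero)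
        finally show ?thesis .
      qed
    qed
    also have "\<dots> = (\<Sum>z\<in>{..<N} \<times> {..k}. ?g s z)"
      by (simp add: sum.cartesian_product case_prod_unfold)
    also have "\<dots> = (\<Sum>i\<in>UNIV. ?g s (\<sigma> i))"
      by (rule sum.reindex_bij_betw[OF \<sigma>, symmetric])
    finally show ?thesis by (simp add: x_eq)
  qed
  then show ?thesis
    by (intro exI[of _ "\<lambda>i. c (fst (\<sigma> i)) (snd (\<sigma> i)) * cell_norm t (fst (\<sigma> i)) (snd (\<sigma> i))"] ext)
qed

lemma legendre_basis_in_pw_poly:
  assumes x: "legendre_basis k N t x" and P: "partition_of a b N t"
  shows "(\<lambda>s. c * x i s) \<in> pw_poly k N t"
proof -
  obtain \<sigma> where \<sigma>: "bij_betw \<sigma> UNIV ({..<N} \<times> {..k})"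
    and x_eq: "\<And>i. x i = cell_legendre_normalized N t (fst (\<sigma> i)) (snd (\<sigma> i))"
    using x unfolding legendre_basis_def by blast
  obtain d l where i: "\<sigma> i = (d, l)" by (cases "\<sigma> i")
  have "d < N" "l \<le> k"
    using bij_betwE[OF \<sigma>] i by (metis UNIV_I mem_Sigma_iff lessThan_iff atMost_iff)+
  have "t d < t (Suc d)" using P \<open>d < N\<close> by (simp add: partition_of_def)
  let ?p = "\<lambda>e. if e = d then smult (c / cell_norm t d l) (scaled_legendre (t d) (t (Suc d)) l) else 0"
  have "(\<lambda>s. c * x i s) = (\<lambda>s. \<Sum>e<N. indicator (cell N t e) s * poly (?p e) s)"
  proof
    fix s
    have "(\<Sum>e<N. indicator (cell N t e) s * poly (?p e) s)
        = (\<Sum>e<N. if e = d then indicator (cell N t d) s * poly (?p d) s else 0)"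
      by (intro sum.cong) auto
    also have "\<dots> = c * x i s"
      using \<open>d < N\<close> by (simp add: x_eq i cell_legendre_normalized_eq)
    finally show "c * x i s = (\<Sum>e<N. indicator (cell N t e) s * poly (?p e) s)" by simp
  qed
  moreover have "\<forall>e<N. degree (?p e) \<le> k"
    using \<open>l \<le> k\<close> degree_scaled_legendre[OF \<open>t d < t (Suc d)\<close>, of l]
    by (simp add: degree_smult_eq)
  ultimately show ?thesis
    unfolding pw_poly_def by (intro CollectI exI[of _ ?p] conjI)
qed

section \<open>Weighted Gram matrices and the weak form\<close>

lemma integrable_weighted_product:
  fixes g p q :: "real \<Rightarrow> real"
  assumes [measurable]: "g \<in> borel_measurable (lebesgue_on {0..emax})"
    and g: "\<And>s. s \<in> {0..emax} \<Longrightarrow> \<bar>g s\<bar> \<le> C"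
    and pq [measurable]: "p \<in> borel_measurable borel" "q \<in> borel_measurable borel"
    and p: "\<And>s. \<bar>p s\<bar> \<le> P" and q: "\<And>s. \<bar>q s\<bar> \<le> Q"
  shows "integrable (lebesgue_on {0..emax}) (\<lambda>s. g s * p s * q s * s\<^sup>2)"
proof (rule integrableI_bounded_set[where A = "{0..emax}" and B = "C * P * Q * emax\<^sup>2"])
  have [measurable]: "p \<in> borel_measurable (lebesgue_on {0..emax})" "q \<in> borel_measurable (lebesgue_on {0..emax})"
    "(\<lambda>s. s\<^sup>2) \<in> borel_measurable (lebesgue_on {0..emax})"
    using pq by (auto intro!: measurable_restrict_space1 measurable_completion)
  show "(\<lambda>s. g s * p s * q s * s\<^sup>2) \<in> borel_measurable (lebesgue_on {0..emax})" by measurable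
  show "AE s in lebesgue_on {0..emax}. s \<in> {0..emax} \<longrightarrow> norm (g s * p s * q s * s\<^sup>2) \<le> C * P * Q * emax\<^sup>2"
  proof (intro AE_I2 impI)
    fix s assume s: "s \<in> {0..emax}"
    then have "s\<^sup>2 \<le> emax\<^sup>2" by (intro power_mono) auto
    moreover have "0 \<le> C" "0 \<le> P" "0 \<le> Q"
      using g[OF s] p[of s] q[of s] by linarith+
    ultimately have "\<bar>g s\<bar> * \<bar>p s\<bar> * \<bar>q s\<bar> * s\<^sup>2 \<le> C * P * Q * emax\<^sup>2"
      using g[OF s] p[of s] q[of s] by (intro mult_mono) auto
    then show "norm (g s * p s * q s * s\<^sup>2) \<le> C * P * Q * emax\<^sup>2" by (simp add: abs_mult)
  qed
qed (auto simp: space_restrict_space sets_restrict_space emeasure_restrict_space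
    emeasure_lborel_Icc_eq)

abbreviation eval_basis :: "('n::finite \<Rightarrow> real \<Rightarrow> real) \<Rightarrow> real \<Rightarrow> real^'n" where
  "eval_basis y s \<equiv> (\<chi> j. y j s)"

lemma fun_of_coeffs_sum: "fun_of_coeffs x y F \<mu> \<epsilon> = (\<Sum>i\<in>UNIV. x i \<mu> * (F $ i \<bullet> eval_basis y \<epsilon>))"
  by (simp add: fun_of_coeffs_def inner_vec_def[of "\<chi> i. x i \<mu>"] matrix_vector_mul_component)

lemma fun_of_coeffs_diff:
  "fun_of_coeffs x y F \<mu> \<epsilon> - fun_of_coeffs x y G \<mu> \<epsilon> = fun_of_coeffs x y (F - G) \<mu> \<epsilon>"
  by (simp add: fun_of_coeffs_sum inner_diff_left algebra_simps sum_subtractf)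

lemma integrable_basis_product:
  assumes y: "legendre_basis k N t y"
    and "g \<in> borel_measurable (lebesgue_on {0..emax})"
    and "\<And>s. s \<in> {0..emax} \<Longrightarrow> \<bar>g s\<bar> \<le> C"
  shows "integrable (lebesgue_on {0..emax}) (\<lambda>s. g s * y i s * y j s * s\<^sup>2)"
  using legendre_basis_bounded[OF y, of i] legendre_basis_bounded[OF y, of j]
    integrable_weighted_product[OF assms(2,3) legendre_basis_measurable[OF y] legendre_basis_measurable[OF y]]
  by blast

lemma has_integral_vform_weighted_gram:
  assumes y: "legendre_basis k N t y"
    and g: "g \<in> borel_measurable (lebesgue_on {0..emax})"
      "\<And>s. s \<in> {0..emax} \<Longrightarrow> \<bar>g s\<bar> \<le> C"
  shows "has_bochner_integral (lebesgue_on {0..emax})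
    (\<lambda>s. g s * (v \<bullet> eval_basis y s) * (w \<bullet> eval_basis y s) * s\<^sup>2) (vform (weighted_gram emax g y) v w)"
proof -
  have "has_bochner_integral (lebesgue_on {0..emax})
      (\<lambda>s. \<Sum>i\<in>UNIV. \<Sum>j\<in>UNIV. v $ i * w $ j * (g s * y i s * y j s * s\<^sup>2))
      (\<Sum>i\<in>UNIV. \<Sum>j\<in>UNIV. v $ i * w $ j * weighted_gram emax g y $ i $ j)"
    using integrable_basis_product[OF y g]
    by (intro has_bochner_integral_sum has_bochner_integral_mult_right)
      (simp_all add: weighted_gram_def has_bochner_integral_integrable)
  moreover have "(\<Sum>i\<in>UNIV. \<Sum>j\<in>UNIV. v $ i * w $ j * (g s * y i s * y j s * s\<^sup>2))
      = g s * (v \<bullet> eval_basis y s) * (w \<bullet> eval_basis y s) * s\<^sup>2" for s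
    by (simp add: inner_vec_def sum_distrib_left sum_distrib_right mult_ac)
  moreover have "(\<Sum>i\<in>UNIV. \<Sum>j\<in>UNIV. v $ i * w $ j * weighted_gram emax g y $ i $ j)
      = vform (weighted_gram emax g y) v w"
    by (simp add: vform_def inner_vec_def matrix_vector_mult_def sum_distrib_left mult_ac)
  ultimately show ?thesis by simp
qed

lemma transpose_weighted_gram: "transpose (weighted_gram emax g y) = weighted_gram emax g y"
  by (simp add: vec_eq_iff transpose_def weighted_gram_def mult_ac)

lemma weighted_gram_mono:
  assumes y: "legendre_basis k N t y"
    and g: "g \<in> borel_measurable (lebesgue_on {0..emax})" "\<And>s. s \<in> {0..emax} \<Longrightarrow> \<bar>g s\<bar> \<le> C"
    and h: "h \<in> borel_measurable (lebesgue_on {0..emax})" "\<And>s. s \<in> {0..emax} \<Longrightarrow> \<bar>h s\<bar> \<le> D"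
    and gh: "\<And>s. s \<in> {0..emax} \<Longrightarrow> g s \<le> h s"
  shows "vform (weighted_gram emax g y) v v \<le> vform (weighted_gram emax h y) v v"
proof -
  note gi = has_integral_vform_weighted_gram[OF y g, of v v]
  note hi = has_integral_vform_weighted_gram[OF y h, of v v]
  have "(LINT s|lebesgue_on {0..emax}. g s * (v \<bullet> eval_basis y s) * (v \<bullet> eval_basis y s) * s\<^sup>2)
      \<le> (LINT s|lebesgue_on {0..emax}. h s * (v \<bullet> eval_basis y s) * (v \<bullet> eval_basis y s) * s\<^sup>2)"
  proof (rule integral_mono)
    fix s assume "s \<in> space (lebesgue_on {0..emax})"
    then have "g s \<le> h s" using gh by simp
    then have "g s * ((v \<bullet> eval_basis y s)\<^sup>2 * s\<^sup>2) \<le> h s * ((v \<bullet> eval_basis y s)\<^sup>2 * s\<^sup>2)"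
      by (intro mult_right_mono) auto
    then show "g s * (v \<bullet> eval_basis y s) * (v \<bullet> eval_basis y s) * s\<^sup>2
        \<le> h s * (v \<bullet> eval_basis y s) * (v \<bullet> eval_basis y s) * s\<^sup>2"
      by (simp add: power2_eq_square mult_ac)
  qed (use gi hi in \<open>auto simp: has_bochner_integral_iff\<close>)
  then show ?thesis using gi hi by (simp add: has_bochner_integral_iff)
qed

lemma weighted_gram_const: "weighted_gram emax (\<lambda>_. c) y = c *\<^sub>R gram_one emax y"
  by (simp add: vec_eq_iff weighted_gram_def mult.assoc)

lemma gram_one_nonneg:
  assumes y: "legendre_basis k N t y"
  shows "0 \<le> vform (gram_one emax y) v v"
proof -
  have "vform (weighted_gram emax (\<lambda>_. 0) y) v v \<le> vform (gram_one emax y) v v"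
    by (rule weighted_gram_mono[OF y, where C = 0 and D = 1]) auto
  then show ?thesis unfolding weighted_gram_const[of emax 0] by (simp add: vform_def)
qed

lemma legendre_basis_inner:
  assumes P: "partition_of a b N t" and x: "legendre_basis k N t x"
  shows "has_bochner_integral (lebesgue_on {a..b})
    (\<lambda>s. (v \<bullet> eval_basis x s) * (w \<bullet> eval_basis x s)) (v \<bullet> w)"
proof -
  have int: "integrable (lebesgue_on {a..b}) (\<lambda>s. x i s * x j s)" for i j
  proof -
    obtain C where C: "\<And>s. \<bar>x i s\<bar> \<le> C" using legendre_basis_bounded[OF x, of i] by blast
    obtain D where D: "\<And>s. \<bar>x j s\<bar> \<le> D" using legendre_basis_bounded[OF x, of j] by blast
    show ?thesis
    proof (rule integrableI_bounded_set[where A = "{a..b}" and B = "C * D"])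
      show "(\<lambda>s. x i s * x j s) \<in> borel_measurable (lebesgue_on {a..b})"
      proof -
        have [measurable]: "x l \<in> borel_measurable borel" for l by (rule legendre_basis_measurable[OF x])
        have "(\<lambda>s. x i s * x j s) \<in> borel_measurable borel" by measurable
        then show ?thesis by (auto intro!: measurable_restrict_space1 measurable_completion)
      qed
      have "0 \<le> C" using C[of a] by linarith
      then show "AE s in lebesgue_on {a..b}. s \<in> {a..b} \<longrightarrow> norm (x i s * x j s) \<le> C * D"
        using C D by (auto simp: abs_mult intro!: mult_mono)
    qed (auto simp: space_restrict_space sets_restrict_space emeasure_restrict_space
    emeasure_lborel_Icc_eq)
  qed
  have "has_bochner_integral (lebesgue_on {a..b})
      (\<lambda>s. \<Sum>i\<in>UNIV. \<Sum>j\<in>UNIV. v $ i * w $ j * (x i s * x j s))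
      (\<Sum>i\<in>UNIV. \<Sum>j\<in>UNIV. v $ i * w $ j * (if i = j then 1 else 0))"
    using int
    by (intro has_bochner_integral_sum has_bochner_integral_mult_right)
      (simp add: has_bochner_integral_iff legendre_basis_orthonormal[OF P x])
  moreover have "(\<Sum>i\<in>UNIV. \<Sum>j\<in>UNIV. v $ i * w $ j * (x i s * x j s))
      = (v \<bullet> eval_basis x s) * (w \<bullet> eval_basis x s)" for s
    by (simp add: inner_vec_def sum_product ac_simps)
  moreover have "(\<Sum>i\<in>UNIV. \<Sum>j\<in>UNIV. v $ i * w $ j * (if i = j then 1 else 0)) = v \<bullet> w"
    by (simp add: inner_vec_def if_distrib[of "\<lambda>z. _ * z"] cong: if_cong)
  ultimately show ?thesis by simp
qed

text \<open>
  The weight vanishes only at \<open>0\<close>, so a function of weighted norm zero is zero almost everywhere, and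
  orthonormality in the unweighted inner product turns this into a statement on its coefficients.
\<close>

lemma gram_one_definite:
  assumes P: "partition_of 0 emax N t" and y: "legendre_basis k N t y"
    and zero: "vform (gram_one emax y) v v = 0"
  shows "v = 0"
proof -
  have "has_bochner_integral (lebesgue_on {0..emax})
      (\<lambda>s. 1 * (v \<bullet> eval_basis y s) * (v \<bullet> eval_basis y s) * s\<^sup>2) 0"
    using has_integral_vform_weighted_gram[OF y, where emax = emax and g = "\<lambda>_. 1" and C = 1 and v = v and w = v] zero by simp
  then have "AE s in lebesgue_on {0..emax}. 1 * (v \<bullet> eval_basis y s) * (v \<bullet> eval_basis y s) * s\<^sup>2 = 0"
    using integral_nonneg_eq_0_iff_AE[of "lebesgue_on {0..emax}"
        "\<lambda>s. 1 * (v \<bullet> eval_basis y s) * (v \<bullet> eval_basis y s) * s\<^sup>2"]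
    by (auto simp: has_bochner_integral_iff)
  moreover have "AE s in lebesgue_on {0..emax}. s \<noteq> 0"
  proof -
    have "AE s in lebesgue. s \<noteq> (0::real)"
      by (rule AE_completion) (rule AE_lborel_singleton)
    then show ?thesis by (auto simp: AE_restrict_space_iff elim: eventually_mono)
  qed
  ultimately have "AE s in lebesgue_on {0..emax}. (v \<bullet> eval_basis y s) * (v \<bullet> eval_basis y s) = 0"
    by eventually_elim auto
  then have "(LINT s|lebesgue_on {0..emax}. (v \<bullet> eval_basis y s) * (v \<bullet> eval_basis y s)) = 0"
    by (rule integral_eq_zero_AE)
  then show ?thesis
    using legendre_basis_inner[OF P y, of v v] by (simp add: has_bochner_integral_iff)
qed

text \<open>
  By orthonormality of the angular basis the integral over the angle becomes a sum over the rows of the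
  coefficient matrices; the Gram matrix collects the integral over the energy.
\<close>

lemma wip_fun_of_coeffs:
  assumes Px: "partition_of (-1) 1 M s" and x: "legendre_basis k M s x"
    and y: "legendre_basis k N t y"
    and g: "g \<in> borel_measurable (lebesgue_on {0..emax})" "\<And>s. s \<in> {0..emax} \<Longrightarrow> \<bar>g s\<bar> \<le> C"
  shows "wip emax (\<lambda>\<mu> \<epsilon>. g \<epsilon> * fun_of_coeffs x y F \<mu> \<epsilon>) (fun_of_coeffs x y W)
    = mform (weighted_gram emax g y) F W"
proof -
  have "(LINT \<mu>|lebesgue_on {-1..1}. g \<epsilon> * fun_of_coeffs x y F \<mu> \<epsilon> * fun_of_coeffs x y W \<mu> \<epsilon> * \<epsilon>\<^sup>2)
      = (\<Sum>i\<in>UNIV. g \<epsilon> * (F $ i \<bullet> eval_basis y \<epsilon>) * (W $ i \<bullet> eval_basis y \<epsilon>) * \<epsilon>\<^sup>2)" for \<epsilon>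
  proof -
    let ?f = "F *v eval_basis y \<epsilon>" and ?w = "W *v eval_basis y \<epsilon>"
    have "(LINT \<mu>|lebesgue_on {-1..1}. (g \<epsilon> * \<epsilon>\<^sup>2) * ((?f \<bullet> eval_basis x \<mu>) * (?w \<bullet> eval_basis x \<mu>)))
        = (g \<epsilon> * \<epsilon>\<^sup>2) * (?f \<bullet> ?w)"
      using legendre_basis_inner[OF Px x, of ?f ?w] by (simp add: has_bochner_integral_iff)
    also have "\<dots> = (\<Sum>i\<in>UNIV. g \<epsilon> * (F $ i \<bullet> eval_basis y \<epsilon>) * (W $ i \<bullet> eval_basis y \<epsilon>) * \<epsilon>\<^sup>2)"
      by (simp add: inner_vec_def[of ?f] matrix_vector_mul_component sum_distrib_left mult_ac)
    finally show ?thesis by (simp add: fun_of_coeffs_def inner_commute mult_ac)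
  qed
  then have "wip emax (\<lambda>\<mu> \<epsilon>. g \<epsilon> * fun_of_coeffs x y F \<mu> \<epsilon>) (fun_of_coeffs x y W)
      = (LINT \<epsilon>|lebesgue_on {0..emax}.
          (\<Sum>i\<in>UNIV. g \<epsilon> * (F $ i \<bullet> eval_basis y \<epsilon>) * (W $ i \<bullet> eval_basis y \<epsilon>) * \<epsilon>\<^sup>2))"
    unfolding wip_def by simp
  also have "\<dots> = mform (weighted_gram emax g y) F W"
    unfolding mform_def
    by (intro has_bochner_integral_integral_eq has_bochner_integral_sum
        has_integral_vform_weighted_gram[OF y g])
  finally show ?thesis .
qed

lemma wip_fun_of_coeffs_one:
  assumes Px: "partition_of (-1) 1 M s" and x: "legendre_basis k M s x"
    and y: "legendre_basis k N t y"
  shows "wip emax (fun_of_coeffs x y F) (fun_of_coeffs x y W) = mform (gram_one emax y) F W"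
  using wip_fun_of_coeffs[OF assms, where emax = emax and g = "\<lambda>_. 1" and C = 1] by simp

text \<open>
  The emissivity is only square integrable for the weight, so the product with a bounded function is
  dominated by means of \<open>\<bar>p q\<bar> \<le> p\<^sup>2 + q\<^sup>2\<close>.
\<close>

lemma integrable_square_weight_times_basis:
  assumes y: "legendre_basis k N t y"
    and eta [measurable]: "eta \<in> borel_measurable (lebesgue_on {0..emax})"
    and eta2: "integrable (lebesgue_on {0..emax}) (\<lambda>\<epsilon>. (eta \<epsilon>)\<^sup>2 * \<epsilon>\<^sup>2)"
  shows "integrable (lebesgue_on {0..emax}) (\<lambda>\<epsilon>. eta \<epsilon> * y j \<epsilon> * \<epsilon>\<^sup>2)"
proof (rule Bochner_Integration.integrable_bound)
  show "integrable (lebesgue_on {0..emax}) (\<lambda>\<epsilon>. (eta \<epsilon>)\<^sup>2 * \<epsilon>\<^sup>2 + 1 * y j \<epsilon> * y j \<epsilon> * \<epsilon>\<^sup>2)"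
    by (intro Bochner_Integration.integrable_add eta2 integrable_basis_product[OF y, where C = 1]) auto
  have [measurable]: "y j \<in> borel_measurable (lebesgue_on {0..emax})"
    "(\<lambda>s. s\<^sup>2) \<in> borel_measurable (lebesgue_on {0..emax})"
    using legendre_basis_measurable[OF y]
    by (auto intro!: measurable_restrict_space1 measurable_completion)
  show "(\<lambda>\<epsilon>. eta \<epsilon> * y j \<epsilon> * \<epsilon>\<^sup>2) \<in> borel_measurable (lebesgue_on {0..emax})" by measurable
  have "\<bar>p * q\<bar> \<le> p\<^sup>2 + q\<^sup>2" for p q :: real
  proof -
    have "0 \<le> (\<bar>p\<bar> - \<bar>q\<bar>)\<^sup>2" by simp
    then have "2 * \<bar>p * q\<bar> \<le> p\<^sup>2 + q\<^sup>2" by (simp add: power2_diff abs_mult)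
    then show ?thesis using abs_ge_zero[of "p * q"] by linarith
  qed
  then have le: "\<bar>eta \<epsilon> * y j \<epsilon>\<bar> * \<epsilon>\<^sup>2 \<le> ((eta \<epsilon>)\<^sup>2 + (y j \<epsilon>)\<^sup>2) * \<epsilon>\<^sup>2" for \<epsilon>
    by (intro mult_right_mono) auto
  have "norm (eta \<epsilon> * y j \<epsilon> * \<epsilon>\<^sup>2) \<le> norm ((eta \<epsilon>)\<^sup>2 * \<epsilon>\<^sup>2 + 1 * y j \<epsilon> * y j \<epsilon> * \<epsilon>\<^sup>2)" for \<epsilon>
  proof -
    have "norm (eta \<epsilon> * y j \<epsilon> * \<epsilon>\<^sup>2) = \<bar>eta \<epsilon> * y j \<epsilon>\<bar> * \<epsilon>\<^sup>2" by (simp add: abs_mult)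
    also have "\<dots> \<le> ((eta \<epsilon>)\<^sup>2 + (y j \<epsilon>)\<^sup>2) * \<epsilon>\<^sup>2" by (rule le)
    also have "\<dots> = (eta \<epsilon>)\<^sup>2 * \<epsilon>\<^sup>2 + 1 * y j \<epsilon> * y j \<epsilon> * \<epsilon>\<^sup>2"
      by (simp add: power2_eq_square algebra_simps)
    also have "\<dots> \<le> norm \<dots>" by simp
    finally show ?thesis .
  qed
  then show "AE \<epsilon> in lebesgue_on {0..emax}.
      norm (eta \<epsilon> * y j \<epsilon> * \<epsilon>\<^sup>2) \<le> norm ((eta \<epsilon>)\<^sup>2 * \<epsilon>\<^sup>2 + 1 * y j \<epsilon> * y j \<epsilon> * \<epsilon>\<^sup>2)" by simp
qed

lemma wip_separable_source:
  assumes x: "legendre_basis k M s x" and y: "legendre_basis k N t y"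
    and eta: "eta \<in> borel_measurable (lebesgue_on {0..emax})"
      "integrable (lebesgue_on {0..emax}) (\<lambda>\<epsilon>. (eta \<epsilon>)\<^sup>2 * \<epsilon>\<^sup>2)"
  shows "wip emax (\<lambda>\<mu> \<epsilon>. eta \<epsilon>) (fun_of_coeffs x y W)
    = column 1 (L0 x) \<bullet> (W *v column 1 (Leta emax eta y))"
proof -
  have x_int: "integrable (lebesgue_on {-1..1}) (\<lambda>\<mu>. x i \<mu>)" for i
  proof -
    obtain C where "\<And>s. \<bar>x i s\<bar> \<le> C" using legendre_basis_bounded[OF x, of i] by blast
    then show ?thesis
      using legendre_basis_measurable[OF x, of i]
      by (intro integrableI_bounded_set[where A = "{-1..1}" and B = C])
        (auto simp: space_restrict_space sets_restrict_space emeasure_restrict_space emeasure_lborel_Icc_eq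
          intro!: measurable_restrict_space1 measurable_completion)
  qed
  have inner: "(LINT \<mu>|lebesgue_on {-1..1}. eta \<epsilon> * fun_of_coeffs x y W \<mu> \<epsilon> * \<epsilon>\<^sup>2)
      = (\<Sum>i\<in>UNIV. \<Sum>j\<in>UNIV. L0 x $ i $ 1 * W $ i $ j * (eta \<epsilon> * y j \<epsilon> * \<epsilon>\<^sup>2))" for \<epsilon>
  proof -
    have "(LINT \<mu>|lebesgue_on {-1..1}. eta \<epsilon> * fun_of_coeffs x y W \<mu> \<epsilon> * \<epsilon>\<^sup>2)
        = (LINT \<mu>|lebesgue_on {-1..1}. (\<Sum>i\<in>UNIV. x i \<mu> * (eta \<epsilon> * (W $ i \<bullet> eval_basis y \<epsilon>) * \<epsilon>\<^sup>2)))"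
      by (simp add: fun_of_coeffs_sum sum_distrib_left sum_distrib_right mult_ac)
    also have "\<dots> = (\<Sum>i\<in>UNIV. L0 x $ i $ 1 * (eta \<epsilon> * (W $ i \<bullet> eval_basis y \<epsilon>) * \<epsilon>\<^sup>2))"
      using x_int by (subst Bochner_Integration.integral_sum) (auto simp: L0_def)
    also have "\<dots> = (\<Sum>i\<in>UNIV. \<Sum>j\<in>UNIV. L0 x $ i $ 1 * W $ i $ j * (eta \<epsilon> * y j \<epsilon> * \<epsilon>\<^sup>2))"
      by (simp add: inner_vec_def sum_distrib_left sum_distrib_right mult_ac)
    finally show ?thesis .
  qed
  have "has_bochner_integral (lebesgue_on {0..emax})
      (\<lambda>\<epsilon>. \<Sum>i\<in>UNIV. \<Sum>j\<in>UNIV. L0 x $ i $ 1 * W $ i $ j * (eta \<epsilon> * y j \<epsilon> * \<epsilon>\<^sup>2))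
      (\<Sum>i\<in>UNIV. \<Sum>j\<in>UNIV. L0 x $ i $ 1 * W $ i $ j * Leta emax eta y $ j $ 1)"
    using integrable_square_weight_times_basis[OF y eta]
    by (intro has_bochner_integral_sum has_bochner_integral_mult_right)
      (simp add: has_bochner_integral_iff Leta_def)
  then show ?thesis
    unfolding wip_def inner
    by (simp add: has_bochner_integral_iff column_def inner_vec_def matrix_vector_mult_def
        sum_distrib_left mult_ac)
qed

text \<open>
  Membership is by pointwise equality, so that coefficients determine the equilibrium as a function and not
  only almost everywhere.
\<close>

lemma tensor_space_fun_of_coeffs:
  fixes x :: "'m::finite \<Rightarrow> real \<Rightarrow> real" and y :: "'n::finite \<Rightarrow> real \<Rightarrow> real"
  assumes Px: "partition_of a b M s" and x: "legendre_basis k M s x"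
    and P: "partition_of c d N t" and y: "legendre_basis k N t y"
    and f: "f \<in> tensor_space (pw_poly k M s) (pw_poly k N t)"
  shows "\<exists>F :: real^'n^'m. f = fun_of_coeffs x y F"
proof -
  obtain q :: nat and v w where vw: "\<And>l. l < q \<Longrightarrow> v l \<in> pw_poly k M s \<and> w l \<in> pw_poly k N t"
    and f_eq: "f = (\<lambda>\<mu> \<epsilon>. \<Sum>l<q. v l \<mu> * w l \<epsilon>)"
    using f unfolding tensor_space_def by blast
  have "\<exists>C. v l = (\<lambda>s. \<Sum>i\<in>UNIV. C i * x i s)" if "l < q" for l
    using legendre_basis_spans[OF Px x] vw[OF that] by blast
  then obtain C where C: "\<And>l. l < q \<Longrightarrow> v l = (\<lambda>s. \<Sum>i\<in>UNIV. C l i * x i s)" by metis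
  have "\<exists>D. w l = (\<lambda>s. \<Sum>j\<in>UNIV. D j * y j s)" if "l < q" for l
    using legendre_basis_spans[OF P y] vw[OF that] by blast
  then obtain D where D: "\<And>l. l < q \<Longrightarrow> w l = (\<lambda>s. \<Sum>j\<in>UNIV. D l j * y j s)" by metis
  have "f \<mu> \<epsilon> = fun_of_coeffs x y (\<chi> i j. \<Sum>l<q. C l i * D l j) \<mu> \<epsilon>" for \<mu> \<epsilon>
  proof -
    have "f \<mu> \<epsilon> = (\<Sum>l<q. \<Sum>i\<in>UNIV. \<Sum>j\<in>UNIV. x i \<mu> * (C l i * D l j * y j \<epsilon>))"
      by (auto simp: f_eq C D sum_product mult_ac intro!: sum.cong)
    also have "\<dots> = (\<Sum>i\<in>UNIV. \<Sum>l<q. \<Sum>j\<in>UNIV. x i \<mu> * (C l i * D l j * y j \<epsilon>))"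
      by (rule sum.swap)
    also have "\<dots> = (\<Sum>i\<in>UNIV. \<Sum>j\<in>UNIV. \<Sum>l<q. x i \<mu> * (C l i * D l j * y j \<epsilon>))"
      by (intro sum.cong refl sum.swap)
    also have "\<dots> = fun_of_coeffs x y (\<chi> i j. \<Sum>l<q. C l i * D l j) \<mu> \<epsilon>"
      by (simp add: fun_of_coeffs_sum inner_vec_def sum_distrib_left sum_distrib_right)
    finally show ?thesis .
  qed
  then show ?thesis by blast
qed

lemma basis_product_in_tensor_space:
  assumes Px: "partition_of a b M s" and x: "legendre_basis k M s x"
    and P: "partition_of c d N t" and y: "legendre_basis k N t y"
  shows "fun_of_coeffs x y (outer (axis i 1) (axis j 1))
    \<in> tensor_space (pw_poly k M s) (pw_poly k N t)"
proof -
  have "(\<lambda>s. 1 * x i s) \<in> pw_poly k M s" "(\<lambda>s. 1 * y j s) \<in> pw_poly k N t"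
    by (intro legendre_basis_in_pw_poly[OF x Px] legendre_basis_in_pw_poly[OF y P])+
  then have "x i \<in> pw_poly k M s" "y j \<in> pw_poly k N t" by simp_all
  moreover have "fun_of_coeffs x y (outer (axis i 1) (axis j 1)) = (\<lambda>\<mu> \<epsilon>. \<Sum>l<(1::nat). x i \<mu> * y j \<epsilon>)"
    by (simp add: fun_eq_iff fun_of_coeffs_def outer_mult_vec inner_axis inner_axis' mult.commute)
  ultimately show ?thesis
    unfolding tensor_space_def
    by (intro CollectI exI[of _ 1] exI[of _ "\<lambda>_. x i"] exI[of _ "\<lambda>_. y j"]) simp
qed

section \<open>The equilibrium in coefficient form\<close>

lemma matrix_vector_mult_axis_inner: "axis i 1 \<bullet> (M *v axis j 1) = (M $ i $ j :: real)"
  by (simp add: inner_axis' matrix_vector_mul_component inner_axis)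

text \<open>
  Testing with all products of two basis functions determines \<^term>\<open>F ** A\<close> entrywise.
\<close>

lemma equilibrium_coefficients:
  fixes A :: "real^'n^'n" and F :: "real^'n^'m"
  assumes sym: "transpose A = A" and definite: "\<And>v. vform A v v = 0 \<Longrightarrow> v = 0"
    and z: "A *v z = b"
    and eq: "\<And>i j. mform A F (outer (axis i 1) (axis j 1)) = a \<bullet> (outer (axis i 1) (axis j 1) *v b)"
  shows "F = outer a z"
proof -
  define H where "H = F - outer a z"
  have "(H ** A) $ i $ j = 0" for i j
  proof -
    have "axis i 1 \<bullet> (F *v (A *v axis j 1)) = a $ i * b $ j"
      using eq[of i j] by (simp add: mform_outer_right outer_mult_vec inner_axis inner_axis' mult.commute)
    moreover have "axis i 1 \<bullet> (outer a z *v (A *v axis j 1)) = a $ i * b $ j"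
    proof -
      have "z \<bullet> (A *v axis j 1) = b $ j"
        using vform_sym[OF sym, of z "axis j 1"] z by (simp add: vform_def inner_axis')
      then show ?thesis by (simp add: outer_mult_vec inner_axis')
    qed
    ultimately have "axis i 1 \<bullet> (H *v (A *v axis j 1)) = 0"
      by (simp add: H_def matrix_vector_mult_diff_rdistrib inner_diff_right)
    then show ?thesis
      using matrix_vector_mult_axis_inner[of i "H ** A" j] by (simp add: matrix_vector_mul_assoc)
  qed
  then have HA: "H ** A = 0" by (simp add: vec_eq_iff)
  have "H $ i = 0" for i
  proof (rule definite)
    have "vform A (H $ i) (H $ i) = (H ** A) $ i \<bullet> H $ i"
      unfolding vform_def
      by (simp add: inner_vec_def matrix_matrix_mult_def matrix_vector_mult_def sum_distrib_left
          sum_distrib_right mult_ac) (subst sum.swap, simp add: mult_ac)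
    then show "vform A (H $ i) (H $ i) = 0" by (simp add: HA)
  qed
  then show ?thesis by (simp add: H_def vec_eq_iff)
qed

lemma invertible_of_definite:
  fixes A :: "real^'n^'n"
  assumes "\<And>v. vform A v v = 0 \<Longrightarrow> v = 0"
  shows "invertible A"
proof -
  have "v = 0" if "A *v v = 0" for v using assms[of v] that by (simp add: vform_def)
  then show ?thesis by (metis invertible_left_inverse matrix_left_invertible_ker)
qed

lemma matrix_inv_right:
  "invertible A \<Longrightarrow> A ** matrix_inv A = mat 1"
  for A :: "real^'n^'n"
  using someI_ex[of "\<lambda>A'. A ** A' = mat 1 \<and> A' ** A = mat 1"]
  unfolding matrix_inv_def invertible_def by blast

lemma matrix_inv_mult_vec:
  fixes A :: "real^'n^'n"
  assumes "invertible A"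
  shows "A *v (matrix_inv A *v v) = v"
  using matrix_inv_right[OF assms] by (simp add: matrix_vector_mul_assoc)

lemma transpose_matrix_inv:
  fixes A :: "real^'n^'n"
  assumes "invertible A" and sym: "transpose A = A"
  shows "transpose (matrix_inv A) = matrix_inv A"
proof -
  have "transpose (matrix_inv A) ** A = mat 1"
    using matrix_inv_right[OF assms(1)] by (metis matrix_transpose_mul sym transpose_mat)
  then have "transpose (matrix_inv A) ** A ** matrix_inv A = matrix_inv A" by simp
  then show ?thesis
    using matrix_inv_right[OF assms(1)] by (simp add: matrix_mul_assoc[symmetric])
qed

lemma norm_column: "norm (C :: real^1^'m) = norm (column 1 C)"
  by (simp add: norm_vec_def L2_set_def column_def)

lemma column_mult: "column 1 (A ** (C :: real^1^'n)) = A *v column 1 C"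
  by (simp add: column_def matrix_matrix_mult_def matrix_vector_mult_def)

lemma column_scaleR: "column 1 (c *\<^sub>R (C :: real^1^'n)) = c *\<^sub>R column 1 C"
  by (simp add: column_def vec_eq_iff)

lemma row_mult: "(transpose (C :: real^1^'n) ** M) $ 1 = transpose M *v column 1 C"
  by (simp add: vec_eq_iff column_def matrix_matrix_mult_def matrix_vector_mult_def transpose_def mult.commute)

text \<open>
  Row matrices reduce the matrix norms of the overlap conditions to vector norms.
\<close>

lemma norm_wrt_row: "norm_wrt A (Z :: real^'n^1) = sqrt (vform A (Z $ 1) (Z $ 1))"
  by (simp add: norm_wrt_def trace_def vform_def matrix_matrix_mult_def transpose_def inner_vec_def
      matrix_vector_mult_def sum_distrib_left sum_distrib_right mult_ac) (subst sum.swap, simp add: mult_ac)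

section \<open>Convergence to the equilibrium\<close>

text \<open>
  The emissivity and the equilibrium have the same weak form, because
  \<^term>\<open>outer (column 1 (L0 x)) z\<close> is the coefficient matrix of the equilibrium; the scheme then
  relaxes the iterate towards it.  The map \<^term>\<open>h\<close> parametrises the Galerkin space, so that the lemma
  covers all three substeps.
\<close>

lemma galerkin_step_coefficients:
  fixes x :: "'m::finite \<Rightarrow> real \<Rightarrow> real" and y :: "'n::finite \<Rightarrow> real \<Rightarrow> real"
  assumes Px: "partition_of (-1) 1 M s" and x: "legendre_basis k M s x"
    and y: "legendre_basis k N t y"
    and eta: "eta \<in> borel_measurable (lebesgue_on {0..emax})"
      "integrable (lebesgue_on {0..emax}) (\<lambda>\<epsilon>. (eta \<epsilon>)\<^sup>2 * \<epsilon>\<^sup>2)"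
    and chi: "chi \<in> borel_measurable (lebesgue_on {0..emax})"
      "\<And>\<epsilon>. \<epsilon> \<in> {0..emax} \<Longrightarrow> \<bar>chi \<epsilon>\<bar> \<le> C"
    and B: "psd_form (vform (weighted_gram emax chi y))"
    and z: "weighted_gram emax chi y *v z = column 1 (Leta emax eta y)"
    and "dt > 0"
    and step: "galerkin_step emax eta chi dt (range (\<lambda>T. fun_of_coeffs x y (h T)))
      (fun_of_coeffs x y F0) (fun_of_coeffs x y F1)"
  shows "mform (gram_one emax y) (F1 - F0) (h T)
    = dt * mform (weighted_gram emax chi y) (outer (column 1 (L0 x)) z - F1) (h T)"
proof -
  let ?B = "weighted_gram emax chi y"
  have mB: "psd_form (mform ?B :: real^'n^'m \<Rightarrow> _)" by (rule psd_mform[OF B])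
  have wip_chi: "wip emax (\<lambda>\<mu> \<epsilon>. chi \<epsilon> * fun_of_coeffs x y F \<mu> \<epsilon>) (fun_of_coeffs x y W)
      = mform ?B F W" for F W
    by (rule wip_fun_of_coeffs[OF Px x y chi])
  have "mform ?B (outer (column 1 (L0 x)) z) (h T)
      = column 1 (L0 x) \<bullet> (h T *v column 1 (Leta emax eta y))"
    using psd_formD(7)[OF mB, of "outer (column 1 (L0 x)) z" "h T"] by (simp add: mform_outer_right z)
  then have "Aform emax eta chi (fun_of_coeffs x y F1) (fun_of_coeffs x y (h T))
      = mform ?B (outer (column 1 (L0 x)) z - F1) (h T)"
    unfolding Aform_def
    by (simp add: wip_separable_source[OF x y eta] wip_chi psd_formD(3)[OF mB])
  moreover have "wip emax (\<lambda>\<mu> \<epsilon>. fun_of_coeffs x y F1 \<mu> \<epsilon> - fun_of_coeffs x y F0 \<mu> \<epsilon>)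
      (fun_of_coeffs x y (h T)) = mform (gram_one emax y) (F1 - F0) (h T)"
    unfolding fun_of_coeffs_diff by (rule wip_fun_of_coeffs_one[OF Px x y])
  moreover have "1 / dt * wip emax (\<lambda>\<mu> \<epsilon>. fun_of_coeffs x y F1 \<mu> \<epsilon> - fun_of_coeffs x y F0 \<mu> \<epsilon>)
      (fun_of_coeffs x y (h T)) = Aform emax eta chi (fun_of_coeffs x y F1) (fun_of_coeffs x y (h T))"
    using step unfolding galerkin_step_def by blast
  ultimately have "1 / dt * mform (gram_one emax y) (F1 - F0) (h T)
      = mform ?B (outer (column 1 (L0 x)) z - F1) (h T)"
    by simp
  then show ?thesis using \<open>dt > 0\<close> by (simp add: field_simps)
qed

theorem theorem4p10:
  fixes emax chi_min chi_max dt \<alpha> \<beta> :: real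
    and eta chi :: "real \<Rightarrow> real"
    and k N_mu N_eps :: nat
    and t_mu t_eps :: "nat \<Rightarrow> real"
    and x :: "'m::finite \<Rightarrow> real \<Rightarrow> real"
    and y :: "'n::finite \<Rightarrow> real \<Rightarrow> real"
    and feq :: "real \<Rightarrow> real \<Rightarrow> real"
    and U U' :: "real^'r::finite^'m"
    and S S' :: "real^'r^'r"
    and E E' :: "real^'r^'n"
  assumes "emax > 0"
    and eta_measurable: "eta \<in> borel_measurable (lebesgue_on {0..emax})"
    and eta_square_integrable: "integrable (lebesgue_on {0..emax}) (\<lambda>\<epsilon>. (eta \<epsilon>)\<^sup>2 * \<epsilon>\<^sup>2)"
    and eta_pos: "\<And>\<epsilon>. \<epsilon> \<in> {0..emax} \<Longrightarrow> eta \<epsilon> > 0"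
    and chi_measurable: "chi \<in> borel_measurable (lebesgue_on {0..emax})"
    and "0 < chi_min"
    and chi_bounds: "\<And>\<epsilon>. \<epsilon> \<in> {0..emax} \<Longrightarrow> chi_min \<le> chi \<epsilon> \<and> chi \<epsilon> \<le> chi_max"
    and partition_mu: "partition_of (-1) 1 N_mu t_mu"
    and partition_eps: "partition_of 0 emax N_eps t_eps"
    and basis_mu: "legendre_basis k N_mu t_mu x"
    and basis_eps: "legendre_basis k N_eps t_eps y"
    and rank_le: "CARD('r) \<le> min CARD('m) CARD('n)"
    and equilibrium: "discrete_equilibrium emax eta chi
          (tensor_space (pw_poly k N_mu t_mu) (pw_poly k N_eps t_eps)) feq"
    and U_orthonormal: "transpose U ** U = mat 1"
    and E_orthonormal: "transpose E ** gram_one emax y ** E = mat 1"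
    and "dt > 0"
    and step: "dlr_dg_step emax eta chi dt x y U S E U' S' E'"
    and "0 < \<beta>" and "\<beta> \<le> 1" and "0 < \<alpha>"
    and overlap_U: "norm (proj_U U ** U_eq x) \<ge> \<beta>"
    and overlap_E: "norm_wrt (gram_one emax y)
          (transpose (E_eq emax eta chi y) ** weighted_gram emax chi y
             ** proj_E (weighted_gram emax chi y) E) \<ge> \<alpha>"
  shows "let f0 = fun_of_coeffs x y (U ** S ** transpose E);
             f1 = fun_of_coeffs x y (U' ** S' ** transpose E');
             r = real CARD('r)
         in (\<forall>\<delta>>0.
               let dt0 = sqrt 2 / \<delta> *
                     max (sqrt r / (\<beta> * chi_min))
                         (sqrt r * sqrt chi_max / (\<alpha> * chi_min powr (3/2)));
                   c = 1 / (1 + dt * chi_min);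
                   delta_chi = (1 + chi_max / chi_min) * \<delta>
               in dt \<ge> dt0 \<longrightarrow>
                  wnorm emax (\<lambda>\<mu> \<epsilon>. f1 \<mu> \<epsilon> - feq \<mu> \<epsilon>)
                    \<le> (c + delta_chi) * wnorm emax (\<lambda>\<mu> \<epsilon>. f0 \<mu> \<epsilon> - feq \<mu> \<epsilon>))
            \<and> (f0 = feq \<longrightarrow> f1 = feq)"
proof -
  let ?A = "gram_one emax y" and ?B = "weighted_gram emax chi y"
  have "0 \<in> {0..emax}" using \<open>emax > 0\<close> by simp
  then have "chi_min \<le> chi_max" using chi_bounds order_trans by blast
  have chi_abs: "\<bar>chi \<epsilon>\<bar> \<le> chi_max" if "\<epsilon> \<in> {0..emax}" for \<epsilon>
    using chi_bounds[OF that] \<open>0 < chi_min\<close> by linarith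
  have A0: "0 \<le> vform ?A v v" for v by (rule gram_one_nonneg[OF basis_eps])
  have A: "psd_form (vform ?A)" by (rule psd_vform[OF transpose_weighted_gram A0])
  have A_definite: "v = 0" if "vform ?A v v = 0" for v
    using gram_one_definite[OF partition_eps basis_eps that] .
  have lower: "chi_min * vform ?A v v \<le> vform ?B v v" for v
  proof -
    have "vform (weighted_gram emax (\<lambda>_. chi_min) y) v v \<le> vform ?B v v"
      by (rule weighted_gram_mono[OF basis_eps _ _ chi_measurable chi_abs, of _ chi_min])
        (use chi_bounds \<open>0 < chi_min\<close> in auto)
    then show ?thesis by (simp add: weighted_gram_const[of emax chi_min] vform_scaleR)
  qed
  have upper: "vform ?B v v \<le> chi_max * vform ?A v v" for v
  proof -
    have "vform ?B v v \<le> vform (weighted_gram emax (\<lambda>_. chi_max) y) v v"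
      by (rule weighted_gram_mono[OF basis_eps chi_measurable chi_abs, of _ chi_max])
        (use chi_bounds \<open>0 < chi_min\<close> \<open>chi_min \<le> chi_max\<close> in auto)
    then show ?thesis by (simp add: weighted_gram_const[of emax chi_max] vform_scaleR)
  qed
  have B0: "0 \<le> vform ?B v v" for v
    using lower[of v] A0[of v] \<open>0 < chi_min\<close> by (smt (verit) mult_nonneg_nonneg)
  have B: "psd_form (vform ?B)" by (rule psd_vform[OF transpose_weighted_gram B0])
  have B_definite: "v = 0" if "vform ?B v v = 0" for v
  proof -
    have "vform ?A v v = 0"
      using lower[of v] A0[of v] \<open>0 < chi_min\<close> that by (simp add: mult_le_0_iff)
    then show ?thesis by (rule A_definite)
  qed
  have B_inv: "invertible ?B" by (rule invertible_of_definite[OF B_definite])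
  define l0 where "l0 = column 1 (L0 x)"
  define leta where "leta = column 1 (Leta emax eta y)"
  define z where "z = matrix_inv ?B *v leta"
  define nz where "nz = sqrt (vform ?A z z)"
  have Bz: "?B *v z = leta" by (simp add: z_def matrix_inv_mult_vec[OF B_inv])
  define Feq where "Feq = outer l0 z"
  have feq: "feq = fun_of_coeffs x y Feq"
  proof -
    obtain F :: "real^'n^'m" where F: "feq = fun_of_coeffs x y F"
      using tensor_space_fun_of_coeffs[OF partition_mu basis_mu partition_eps basis_eps]
        equilibrium unfolding discrete_equilibrium_def by blast
    have wip_chi: "wip emax (\<lambda>\<mu> \<epsilon>. chi \<epsilon> * fun_of_coeffs x y G \<mu> \<epsilon>) (fun_of_coeffs x y W)
        = mform ?B G W" for G W :: "real^'n^'m"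
      by (rule wip_fun_of_coeffs[OF partition_mu basis_mu basis_eps chi_measurable chi_abs])
    have "F = outer l0 z"
    proof (rule equilibrium_coefficients[OF transpose_weighted_gram B_definite Bz])
      fix i j
      let ?W = "outer (axis i 1) (axis j 1) :: real^'n^'m"
      have "Aform emax eta chi feq (fun_of_coeffs x y ?W) = 0"
        using equilibrium
          basis_product_in_tensor_space[OF partition_mu basis_mu partition_eps basis_eps]
        unfolding discrete_equilibrium_def by blast
      then show "mform ?B F ?W = l0 \<bullet> (?W *v leta)"
        unfolding Aform_def F
        by (simp add: wip_chi
            wip_separable_source[OF basis_mu basis_eps eta_measurable
              eta_square_integrable] l0_def leta_def)
    qed
    then show ?thesis using F by (simp add: Feq_def)
  qed
  define u where "u = (1 / norm l0) *\<^sub>R l0"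
  define e where "e = (1 / nz) *\<^sub>R z"
  have u: "column 1 (U_eq x) = u"
    by (simp add: U_eq_def u_def column_scaleR norm_column[of "L0 x"] l0_def)
  have e: "column 1 (E_eq emax eta chi y) = e"
    unfolding E_eq_def Let_def
    by (simp add: column_scaleR column_mult norm_wrt_row row_mult
        transpose_matrix_inv[OF B_inv transpose_weighted_gram] leta_def[symmetric] z_def[symmetric]
        nz_def[symmetric] e_def)
  have overlap_u: "\<beta> \<le> norm (U *v (transpose U *v u))"
  proof -
    have "norm (proj_U U ** U_eq x) = norm (column 1 (proj_U U ** U_eq x))" by (rule norm_column)
    also have "\<dots> = norm (U *v (transpose U *v u))"
      by (simp add: column_mult u proj_U_def matrix_vector_mul_assoc)
    finally show ?thesis using overlap_U by simp
  qed
  \<comment> \<open>A vanishing normalisation is excluded by the overlap conditions: division by zero would turn the unit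
    vector into zero, here and for \<^term>\<open>nz\<close> below.\<close>
  have "l0 \<noteq> 0"
  proof
    assume "l0 = 0"
    then show False using overlap_u \<open>0 < \<beta>\<close> by (simp add: u_def)
  qed
  let ?G = "transpose E ** ?B ** E"
  have EA: "transpose E *v (?A *v (E *v c)) = c" for c
    by (simp add: matrix_vector_mul_assoc matrix_mul_assoc E_orthonormal)
  have G_inv: "invertible ?G"
  proof (rule invertible_of_definite)
    fix c assume "vform ?G c c = 0"
    then have "E *v c = 0" by (intro B_definite) (simp add: vform_congruence)
    then show "c = 0" using EA[of c] by simp
  qed
  have G_sym: "transpose ?G = ?G"
    by (simp add: matrix_transpose_mul transpose_weighted_gram matrix_mul_assoc)
  define p where "p = matrix_inv ?G *v (transpose E *v (?B *v e))"
  have p: "?G *v p = transpose E *v (?B *v e)"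
    by (simp add: p_def matrix_inv_mult_vec[OF G_inv])
  have "(transpose (E_eq emax eta chi y) ** ?B ** proj_E ?B E) $ 1 = E *v p"
  proof -
    have "(transpose (E_eq emax eta chi y) ** (?B ** proj_E ?B E)) $ 1 = E *v p"
      unfolding row_mult e
      by (simp add: proj_E_def matrix_transpose_mul transpose_weighted_gram
          transpose_matrix_inv[OF G_inv G_sym] p_def matrix_vector_mul_assoc matrix_mul_assoc)
    then show ?thesis by (simp add: matrix_mul_assoc)
  qed
  then have overlap_p: "\<alpha> \<le> norm p"
    using overlap_E by (simp add: norm_wrt_row vform_congruence E_orthonormal)
      (simp add: vform_def norm_eq_sqrt_inner)
  have "nz \<noteq> 0"
  proof
    assume "nz = 0"
    then show False using overlap_p \<open>0 < \<alpha>\<close> by (simp add: p_def e_def)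
  qed
  then have "0 < nz" using A0[of z] by (simp add: nz_def less_le)
  define s where "s = norm l0 * nz"
  have "0 \<le> s" using \<open>0 < nz\<close> by (simp add: s_def)
  have Feq_s: "Feq = s *\<^sub>R outer u e"
    using \<open>l0 \<noteq> 0\<close> \<open>nz \<noteq> 0\<close> by (simp add: Feq_def s_def u_def e_def outer_def vec_eq_iff)
  have "u \<bullet> u = 1"
    using \<open>l0 \<noteq> 0\<close> by (simp add: u_def power2_norm_eq_inner[symmetric] power2_eq_square)
  have "vform ?A e e = 1"
  proof -
    have "vform ?A z z = nz * nz" using A0[of z] by (simp add: nz_def)
    then show ?thesis using \<open>nz \<noteq> 0\<close> by (simp add: e_def psd_formD(5,6)[OF A])
  qed
  define F0 where "F0 = U ** S ** transpose E"
  define F1 where "F1 = U' ** S' ** transpose E'"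
  note galerkin = galerkin_step_coefficients[OF partition_mu basis_mu basis_eps
      eta_measurable eta_square_integrable chi_measurable chi_abs B Bz[unfolded leta_def] \<open>dt > 0\<close>,
      folded l0_def Feq_def]
  obtain K RK L RL where K: "K = U' ** RK" and L: "L = E' ** RL"
    and K_galerkin: "galerkin_step emax eta chi dt
        (range (\<lambda>W :: real^'r^'m. fun_of_coeffs x y (W ** transpose E)))
        (fun_of_coeffs x y F0) (fun_of_coeffs x y (K ** transpose E))"
    and L_galerkin: "galerkin_step emax eta chi dt
        (range (\<lambda>W :: real^'r^'n. fun_of_coeffs x y (U ** transpose W)))
        (fun_of_coeffs x y F0) (fun_of_coeffs x y (U ** transpose L))"
    and U'_orth: "transpose U' ** U' = mat 1" and E'_orth: "transpose E' ** ?A ** E' = mat 1"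
    and S_galerkin: "galerkin_step emax eta chi dt
        (range (\<lambda>T :: real^'r^'r. fun_of_coeffs x y (U' ** T ** transpose E')))
        (fun_of_coeffs x y F0) (fun_of_coeffs x y F1)"
    using step unfolding dlr_dg_step_def Let_def F0_def F1_def by blast
  let ?r = "real CARD('r)"
  let ?max = "max (sqrt ?r / (\<beta> * chi_min)) (sqrt ?r * sqrt chi_max / (\<alpha> * chi_min powr (3/2)))"
  let ?err = "\<lambda>F. sqrt (mform ?A (F - Feq) (F - Feq))"
  \<comment> \<open>The rank is at least one, so the threshold on \<^term>\<open>dt\<close> dominates those of
    \<open>dlr_step_matrix_error\<close>.\<close>
  have "1 \<le> sqrt ?r" by simp
  have main: "?err F1 \<le> (1 / (1 + dt * chi_min) + (1 + chi_max / chi_min) * \<delta>) * ?err F0"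
    if "0 < \<delta>" and dt: "sqrt 2 / \<delta> * ?max \<le> dt" for \<delta>
  proof -
    have powr: "chi_min powr (3/2) = chi_min * sqrt chi_min"
      using powr_add[of chi_min 1 "1/2"] \<open>0 < chi_min\<close> by (simp add: powr_half_sqrt)
    have "1 / (\<beta> * chi_min) \<le> sqrt ?r / (\<beta> * chi_min)"
      using \<open>1 \<le> sqrt ?r\<close> \<open>0 < \<beta>\<close> \<open>0 < chi_min\<close> by (intro divide_right_mono) auto
    then have "1 / (\<beta> * chi_min) \<le> ?max" by linarith
    then have "sqrt 2 / \<delta> * (1 / (\<beta> * chi_min)) \<le> sqrt 2 / \<delta> * ?max"
      using \<open>0 < \<delta>\<close> by (intro mult_left_mono) auto
    then have dt_\<beta>: "sqrt 2 / \<delta> * (1 / (\<beta> * chi_min)) \<le> dt" using dt by linarith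
    have "sqrt (chi_max / chi_min) / (\<alpha> * chi_min) = 1 * sqrt chi_max / (\<alpha> * chi_min powr (3/2))"
      by (simp add: powr real_sqrt_divide mult_ac)
    also have "\<dots> \<le> sqrt ?r * sqrt chi_max / (\<alpha> * chi_min powr (3/2))"
      using \<open>1 \<le> sqrt ?r\<close> \<open>0 < \<alpha>\<close> \<open>0 < chi_min\<close> \<open>chi_min \<le> chi_max\<close>
      by (intro divide_right_mono mult_right_mono) auto
    finally have "sqrt (chi_max / chi_min) / (\<alpha> * chi_min) \<le> ?max" by linarith
    then have "sqrt 2 / \<delta> * (sqrt (chi_max / chi_min) / (\<alpha> * chi_min)) \<le> sqrt 2 / \<delta> * ?max"
      using \<open>0 < \<delta>\<close> by (intro mult_left_mono) auto
    then have dt_\<alpha>: "sqrt 2 / \<delta> * (sqrt (chi_max / chi_min) / (\<alpha> * chi_min)) \<le> dt"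
      using dt by linarith
    show ?thesis
      by (rule dlr_step_matrix_error[OF A B A_definite \<open>0 < chi_min\<close> \<open>chi_min \<le> chi_max\<close> lower upper
            U_orthonormal E_orthonormal U'_orth E'_orth Feq_s \<open>u \<bullet> u = 1\<close> \<open>vform ?A e e = 1\<close> \<open>0 \<le> s\<close> p
            \<open>0 < \<alpha>\<close> overlap_p \<open>0 < \<beta>\<close> overlap_u \<open>dt > 0\<close> \<open>0 < \<delta>\<close> dt_\<beta> dt_\<alpha> F0_def F1_def K L
            galerkin[OF _ K_galerkin] galerkin[OF _ L_galerkin] galerkin[OF _ S_galerkin]])
  qed
  have wnorm: "wnorm emax (\<lambda>\<mu> \<epsilon>. fun_of_coeffs x y F \<mu> \<epsilon> - feq \<mu> \<epsilon>) = ?err F" for F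
    unfolding feq wnorm_def fun_of_coeffs_diff
    by (simp add: wip_fun_of_coeffs_one[OF partition_mu basis_mu basis_eps])
  have fixpoint: "fun_of_coeffs x y F1 = feq" if "fun_of_coeffs x y F0 = feq"
  proof -
    have "0 < ?max"
      using \<open>1 \<le> sqrt ?r\<close> \<open>0 < \<beta>\<close> \<open>0 < chi_min\<close> by (intro less_max_iff_disj[THEN iffD2] disjI1 divide_pos_pos) auto
    then have "0 < sqrt 2 / dt * ?max" using \<open>dt > 0\<close> by (intro mult_pos_pos) auto
    \<comment> \<open>The choice of \<open>\<delta>\<close> makes \<^term>\<open>dt\<close> equal to the threshold.\<close>
    moreover from \<open>0 < ?max\<close> have "sqrt 2 / (sqrt 2 / dt * ?max) * ?max \<le> dt" by simp
    moreover have "?err F0 = 0"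
      using wnorm[of F0] that by (simp add: wnorm_def wip_def)
    ultimately have "?err F1 \<le> 0" using main by fastforce
    then have zero: "mform ?A (F1 - Feq) (F1 - Feq) = 0"
      using psd_formD(8)[OF psd_mform[OF A], of "F1 - Feq"] by simp
    have "F1 - Feq = 0" by (rule mform_definite[OF A _ zero]) (rule A_definite)
    then show ?thesis by (simp add: feq)
  qed
  show ?thesis
    unfolding Let_def F0_def[symmetric] F1_def[symmetric] wnorm
    using main fixpoint by blast
qed

end
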